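(* Let $N>1$ and let $Q$ be an (anonymous) probability function defining a Markovian policy for the $N$-armed bandit problem. If $Q$ is recurrent and leading-arm convergent, then for every problem instance $\Theta$, with optimal arm $i^*$, $\Pr(a(t)=i^* )\to1$ as $t\to\infty$. As a result, the regret satisfies $\mathcal R^\Theta(T)=o(T)$ and the policy is long-run-average optimal, i.e. it maximizes $\limsup_{T\to\infty}\frac1T\,\mathbb E\big[\sum_{t=1}^T r_{a(t)}(t)\big]$ over all admissible policies.
   Context: Bandit problem. There are $N$ arms, $[N]=\{1,\dots,N\}$. Each arm $i$ has an i.i.d. reward sequence $\{r_i(t)\}_{t\ge1}$ drawn from a fixed distribution supported on $[0,1]$ with mean $\mu_i$; the collection of reward distributions is the instance $\Theta$. The optimal arm $i^*=\arg\max_i\mu_i$ is assumed unique, and $\mu^*=\max_i\mu_i$. At each time $t=1,2,\dots$ an action $a(t)\in[N]$ is chosen and the reward $r_{a(t)}(t)$ is observed; conditionally on the past and on $a(t)=i$, this reward has arm $i$'s distribution. An admissible policy maps each history $(a(1),r_{a(1)}(1),\dots,a(t-1),r_{a(t-1)}(t-1))$ to a (possibly randomized) action $a(t)$. The regret on instance $\Theta$ is $\mathcal R^\Theta(T)=\mu^*T-\mathbb E\big[\sum_{t=1}^T r_{a(t)}(t)\big]$. Markovian policies. Let $k_i(t)=\sum_{\ell=1}^{t-1}\mathbb I\{a(\ell)=i\}$ and $\hat\mu_i(t)=\frac{1}{k_i(t)+1}\sum_{\ell\le t-1:\,a(\ell)=i} r_i(\ell)$. The state at time $t$ is $\mathbf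 S(t)=(k_1(t),\dots,k_N(t),\hat\mu_1(t),\dots,\hat\mu_N(t))\in\mathcal S=\mathbb Z_+^N\times[0,1]^N$, where $\mathbb Z_+=\{0,1,2,\dots\}$. A policy is given by a function $Q=(Q_1,\dots,Q_N)$ from $\mathcal S$ to the probability vectors on $[N]$: given the history up to time $t$, arm $i$ is pulled with probability $Q_i(\mathbf S(t))$. A state is written $S=(\kappa,u)$, $\kappa\in\mathbb Z_+^N$, $u\in[0,1]^N$; $S^i=(\kappa_i,u_i)$, $S^{-i}$ denotes the state values of the other arms, and $Q_i(S)=Q_i(S^i;S^{-i})$. Anonymous (standing assumption on $Q$): for every permutation $\sigma$ of $[N]$, every $i$ and every state, $Q_i(\kappa_{\sigma(1)},\dots,\kappa_{\sigma(N)},u_{\sigma(1)},\dots,u_{\sigma(N)})=Q_{\sigma(i)}(\kappa_1,\dots,\kappa_N,u_1,\dots,u_N)$. Recurrent: for every $S^1=(\kappa_1,u_1)\in\mathbb Z_+\times[0,1]$ there exists $\varepsilon>0$ (possibly depending on $S^1$) with $Q_1(S^1;S^{-1})\ge\varepsilon$ for all $S^{-1}$. Leading-arm convergent: for every sequence of states $(\kappa,u)=(\kappa(T),u(T))$, $T=1,2,\dots$, with $\kappa_i=\omega(1)$ for every $i\in[N]$ and $u_1-u_i=\Omega(1)$ for every $i\ge2$, one has $1-Q_1(\kappa,u)=o(1)$. Notation (as $T\to\infty$): $f=o(g)$ means $\limsup f/g=0$; $f=\Omega(g)$ means $\liminf f/g>0$; $f=\omega(g)$ means $\liminf f/g=\infty$.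 *)

theory Defs
  imports "HOL-Probability.Probability" "HOL-Combinatorics.Permutations"
begin

section \<open>Signed asymptotic comparison\<close>

text \<open>
  Unlike the notions of \<^theory>\<open>HOL-Library.Landau_Symbols\<close>, these compare the signed quotient
  \<open>f / g\<close>, not absolute values; the sign matters for \<open>asymp_Omega\<close>.
\<close>

definition asymp_o :: "(nat \<Rightarrow> real) \<Rightarrow> (nat \<Rightarrow> real) \<Rightarrow> bool" where
  "asymp_o f g \<longleftrightarrow> limsup (\<lambda>T. ereal (f T / g T)) = 0"

definition asymp_Omega :: "(nat \<Rightarrow> real) \<Rightarrow> (nat \<Rightarrow> real) \<Rightarrow> bool" where
  "asymp_Omega f g \<longleftrightarrow> liminf (\<lambda>T. ereal (f T / g T)) > 0"

definition asymp_omega :: "(nat \<Rightarrow> real) \<Rightarrow> (nat \<Rightarrow> real) \<Rightarrow> bool" where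
  "asymp_omega f g \<longleftrightarrow> liminf (\<lambda>T. ereal (f T / g T)) = \<infinity>"


section \<open>Instances\<close>

definition reward_space :: "real measure" where
  "reward_space = restrict_space borel {0..1}"

definition arm_mean :: "(nat \<Rightarrow> real measure) \<Rightarrow> nat \<Rightarrow> real" where
  "arm_mean \<Theta> i = (\<integral>x. x \<partial>\<Theta> i)"

definition bandit_instance :: "nat \<Rightarrow> (nat \<Rightarrow> real measure) \<Rightarrow> bool" where
  "bandit_instance N \<Theta> \<longleftrightarrow>
     (\<forall>i\<in>{1..N}. \<Theta> i \<in> space (prob_algebra reward_space)) \<and>
     (\<exists>!i. is_arg_max (arm_mean \<Theta>) (\<lambda>i. i \<in> {1..N}) i)"

definition optimal_arm :: "nat \<Rightarrow> (nat \<Rightarrow> real measure) \<Rightarrow> nat" where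
  "optimal_arm N \<Theta> = (ARG_MAX (arm_mean \<Theta>) i. i \<in> {1..N})"

definition optimal_mean :: "nat \<Rightarrow> (nat \<Rightarrow> real measure) \<Rightarrow> real" where
  "optimal_mean N \<Theta> = Max (arm_mean \<Theta> ` {1..N})"


section \<open>Policies and the process they generate\<close>

text \<open>
  Rounds are counted from \<open>0\<close>: coordinate \<open>t\<close> of a trajectory is the pair of the action and the
  observed reward at time \<open>t + 1\<close>. A policy maps the history of the first \<open>t\<close> rounds to the
  distribution of the action in round \<open>t\<close>; the measurability requirement is what makes the process
  well defined.
\<close>

definition round_space :: "nat \<Rightarrow> (nat \<times> real) measure" where
  "round_space N = count_space {1..N} \<Otimes>\<^sub>M reward_space"

definition admissible_policy :: "nat \<Rightarrow> (nat \<Rightarrow> (nat \<Rightarrow> nat \<times> real) \<Rightarrow> nat measure) \<Rightarrow> bool" where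
  "admissible_policy N \<pi> \<longleftrightarrow>
     (\<forall>t. \<pi> t \<in> PiM {0..<t} (\<lambda>_. round_space N) \<rightarrow>\<^sub>M prob_algebra (count_space {1..N}))"

definition bandit_step ::
    "nat \<Rightarrow> (nat \<Rightarrow> real measure) \<Rightarrow> (nat \<Rightarrow> (nat \<Rightarrow> nat \<times> real) \<Rightarrow> nat measure) \<Rightarrow>
     nat \<Rightarrow> (nat \<Rightarrow> nat \<times> real) \<Rightarrow> (nat \<times> real) measure" where
  "bandit_step N \<Theta> \<pi> t h =
     bind (\<pi> t h) (\<lambda>i. bind (\<Theta> i) (\<lambda>r. return (round_space N) (i, r)))"

text \<open>
  The law of the infinite trajectory, given by the Ionescu-Tulcea theorem; for admissible policies
  the assumptions of that theorem are established in \<open>Ionescu_Tulcea_bandit_step\<close> below.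
\<close>

definition bandit_process ::
    "nat \<Rightarrow> (nat \<Rightarrow> real measure) \<Rightarrow> (nat \<Rightarrow> (nat \<Rightarrow> nat \<times> real) \<Rightarrow> nat measure) \<Rightarrow>
     (nat \<Rightarrow> nat \<times> real) measure" where
  "bandit_process N \<Theta> \<pi> =
     projective_family.lim UNIV
       (Ionescu_Tulcea.CI (bandit_step N \<Theta> \<pi>) (\<lambda>_. round_space N)) (\<lambda>_. round_space N)"

definition pull_prob ::
    "nat \<Rightarrow> (nat \<Rightarrow> real measure) \<Rightarrow> (nat \<Rightarrow> (nat \<Rightarrow> nat \<times> real) \<Rightarrow> nat measure) \<Rightarrow>
     nat \<Rightarrow> nat \<Rightarrow> real" where
  "pull_prob N \<Theta> \<pi> t i = \<P>(\<omega> in bandit_process N \<Theta> \<pi>. fst (\<omega> t) = i)"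

definition expected_reward ::
    "nat \<Rightarrow> (nat \<Rightarrow> real measure) \<Rightarrow> (nat \<Rightarrow> (nat \<Rightarrow> nat \<times> real) \<Rightarrow> nat measure) \<Rightarrow>
     nat \<Rightarrow> real" where
  "expected_reward N \<Theta> \<pi> T = (\<integral>\<omega>. (\<Sum>t<T. snd (\<omega> t)) \<partial>bandit_process N \<Theta> \<pi>)"

definition regret ::
    "nat \<Rightarrow> (nat \<Rightarrow> real measure) \<Rightarrow> (nat \<Rightarrow> (nat \<Rightarrow> nat \<times> real) \<Rightarrow> nat measure) \<Rightarrow>
     nat \<Rightarrow> real" where
  "regret N \<Theta> \<pi> T = optimal_mean N \<Theta> * real T - expected_reward N \<Theta> \<pi> T"

definition long_run_average ::
    "nat \<Rightarrow> (nat \<Rightarrow> real measure) \<Rightarrow> (nat \<Rightarrow> (nat \<Rightarrow> nat \<times> real) \<Rightarrow> nat measure) \<Rightarrow> ereal" where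
  "long_run_average N \<Theta> \<pi> = limsup (\<lambda>T. ereal (expected_reward N \<Theta> \<pi> T / real T))"


section \<open>Markovian policies\<close>

text \<open>
  A state is a pair \<open>(\<kappa>, u)\<close> of vectors indexed by \<open>{1..N}\<close> (undefined elsewhere); the set of
  states is the space of the following measure space.
\<close>

definition state_space :: "nat \<Rightarrow> ((nat \<Rightarrow> nat) \<times> (nat \<Rightarrow> real)) measure" where
  "state_space N =
     PiM {1..N} (\<lambda>_. count_space UNIV) \<Otimes>\<^sub>M PiM {1..N} (\<lambda>_. restrict_space borel {0..1})"

definition pull_count :: "nat \<Rightarrow> (nat \<Rightarrow> nat \<times> real) \<Rightarrow> nat \<Rightarrow> nat" where
  "pull_count t h i = card {l. l < t \<and> fst (h l) = i}"

definition empirical_mean :: "nat \<Rightarrow> (nat \<Rightarrow> nat \<times> real) \<Rightarrow> nat \<Rightarrow> real" where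
  "empirical_mean t h i =
     (\<Sum>l | l < t \<and> fst (h l) = i. snd (h l)) / (real (pull_count t h i) + 1)"

definition bandit_state ::
    "nat \<Rightarrow> nat \<Rightarrow> (nat \<Rightarrow> nat \<times> real) \<Rightarrow> (nat \<Rightarrow> nat) \<times> (nat \<Rightarrow> real)" where
  "bandit_state N t h =
     (restrict (pull_count t h) {1..N}, restrict (empirical_mean t h) {1..N})"

text \<open>
  \<open>Q i S\<close> is the probability of pulling arm \<open>i\<close> in state \<open>S\<close>. Borel measurability is needed for
  \<open>Q\<close> to define a policy.
\<close>

definition probability_function ::
    "nat \<Rightarrow> (nat \<Rightarrow> (nat \<Rightarrow> nat) \<times> (nat \<Rightarrow> real) \<Rightarrow> real) \<Rightarrow> bool" where
  "probability_function N Q \<longleftrightarrow>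
     (\<forall>i\<in>{1..N}. Q i \<in> borel_measurable (state_space N)) \<and>
     (\<forall>S\<in>space (state_space N). (\<forall>i\<in>{1..N}. 0 \<le> Q i S) \<and> (\<Sum>i=1..N. Q i S) = 1)"

definition markov_policy ::
    "nat \<Rightarrow> (nat \<Rightarrow> (nat \<Rightarrow> nat) \<times> (nat \<Rightarrow> real) \<Rightarrow> real) \<Rightarrow>
     nat \<Rightarrow> (nat \<Rightarrow> nat \<times> real) \<Rightarrow> nat measure" where
  "markov_policy N Q t h = point_measure {1..N} (\<lambda>i. ennreal (Q i (bandit_state N t h)))"

definition anonymous ::
    "nat \<Rightarrow> (nat \<Rightarrow> (nat \<Rightarrow> nat) \<times> (nat \<Rightarrow> real) \<Rightarrow> real) \<Rightarrow> bool" where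
  "anonymous N Q \<longleftrightarrow>
     (\<forall>\<sigma>. \<sigma> permutes {1..N} \<longrightarrow>
       (\<forall>i\<in>{1..N}. \<forall>(\<kappa>, u)\<in>space (state_space N). Q i (\<kappa> \<circ> \<sigma>, u \<circ> \<sigma>) = Q (\<sigma> i) (\<kappa>, u)))"

definition recurrent ::
    "nat \<Rightarrow> (nat \<Rightarrow> (nat \<Rightarrow> nat) \<times> (nat \<Rightarrow> real) \<Rightarrow> real) \<Rightarrow> bool" where
  "recurrent N Q \<longleftrightarrow>
     (\<forall>k. \<forall>x\<in>{0..1}. \<exists>\<epsilon>>0. \<forall>(\<kappa>, u)\<in>space (state_space N).
        \<kappa> 1 = k \<and> u 1 = x \<longrightarrow> Q 1 (\<kappa>, u) \<ge> \<epsilon>)"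

definition leading_arm_convergent ::
    "nat \<Rightarrow> (nat \<Rightarrow> (nat \<Rightarrow> nat) \<times> (nat \<Rightarrow> real) \<Rightarrow> real) \<Rightarrow> bool" where
  "leading_arm_convergent N Q \<longleftrightarrow>
     (\<forall>\<kappa> u. (\<forall>T. (\<kappa> T, u T) \<in> space (state_space N)) \<longrightarrow>
        (\<forall>i\<in>{1..N}. asymp_omega (\<lambda>T. real (\<kappa> T i)) (\<lambda>_. 1)) \<longrightarrow>
        (\<forall>i\<in>{2..N}. asymp_Omega (\<lambda>T. u T 1 - u T i) (\<lambda>_. 1)) \<longrightarrow>
        asymp_o (\<lambda>T. 1 - Q 1 (\<kappa> T, u T)) (\<lambda>_. 1))"


section \<open>Well-definedness\<close>

lemma measurable_bandit_step:
  assumes "bandit_instance N \<Theta>" and "admissible_policy N \<pi>"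
  shows "bandit_step N \<Theta> \<pi> t \<in>
           PiM {0..<t} (\<lambda>_. round_space N) \<rightarrow>\<^sub>M prob_algebra (round_space N)"
proof -
  have \<pi>: "\<pi> t \<in> PiM {0..<t} (\<lambda>_. round_space N) \<rightarrow>\<^sub>M prob_algebra (count_space {1..N})"
    using assms(2) by (simp add: admissible_policy_def)
  have \<Theta>: "\<Theta> i \<in> space (prob_algebra reward_space)" if "i \<in> {1..N}" for i
    using assms(1) that by (auto simp: bandit_instance_def)
  have "(\<lambda>i. bind (\<Theta> i) (\<lambda>r. return (round_space N) (i, r))) \<in>
          count_space {1..N} \<rightarrow>\<^sub>M prob_algebra (round_space N)"
  proof (rule measurable_bind_prob_space2[where N = reward_space])
    show "\<Theta> \<in> count_space {1..N} \<rightarrow>\<^sub>M prob_algebra reward_space"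
      using \<Theta> by simp
    show "(\<lambda>(i, r). return (round_space N) (i, r)) \<in>
            count_space {1..N} \<Otimes>\<^sub>M reward_space \<rightarrow>\<^sub>M prob_algebra (round_space N)"
      unfolding round_space_def by simp
  qed
  then show ?thesis
    unfolding bandit_step_def by (intro measurable_bind_prob_space[OF \<pi>])
qed

lemma Ionescu_Tulcea_bandit_step:
  assumes "bandit_instance N \<Theta>" and "admissible_policy N \<pi>"
  shows "Ionescu_Tulcea (bandit_step N \<Theta> \<pi>) (\<lambda>_. round_space N)"
proof (rule Ionescu_Tulcea.intro)
  show "bandit_step N \<Theta> \<pi> t \<in> PiM {0..<t} (\<lambda>_. round_space N) \<rightarrow>\<^sub>M subprob_algebra (round_space N)"
    for t
    by (rule measurable_prob_algebraD[OF measurable_bandit_step[OF assms]])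
  show "prob_space (bandit_step N \<Theta> \<pi> t h)" if "h \<in> space (PiM {0..<t} (\<lambda>_. round_space N))" for t h
    using measurable_space[OF measurable_bandit_step[OF assms] that]
    by (simp add: space_prob_algebra)
qed

lemma measurable_bandit_state:
  "bandit_state N t \<in> PiM {0..<t} (\<lambda>_. round_space N) \<rightarrow>\<^sub>M state_space N"
proof -
  let ?H = "PiM {0..<t} (\<lambda>_. round_space N)"
  have act [measurable]: "Measurable.pred ?H (\<lambda>h. fst (h l) = i)" if "l < t" for l i
  proof -
    have "(\<lambda>h. h l) \<in> ?H \<rightarrow>\<^sub>M round_space N"
      using that by (intro measurable_component_singleton) auto
    then have "(\<lambda>h. fst (h l)) \<in> ?H \<rightarrow>\<^sub>M count_space {1..N}"
      unfolding round_space_def by (rule measurable_compose[OF _ measurable_fst])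
    then show ?thesis
      by (rule measurable_compose) simp
  qed
  have rew [measurable]: "(\<lambda>h. snd (h l)) \<in> borel_measurable ?H" if "l < t" for l
  proof -
    have "(\<lambda>h. h l) \<in> ?H \<rightarrow>\<^sub>M round_space N"
      using that by (intro measurable_component_singleton) auto
    then have "(\<lambda>h. snd (h l)) \<in> ?H \<rightarrow>\<^sub>M reward_space"
      unfolding round_space_def by (rule measurable_compose[OF _ measurable_snd])
    then show ?thesis
      unfolding reward_space_def by (simp add: measurable_restrict_space2_iff)
  qed
  have count_eq: "pull_count t h i = (\<Sum>l<t. if fst (h l) = i then 1 else 0)" for h i
    unfolding pull_count_def by (simp add: sum.If_cases Collect_conj_eq lessThan_def)
  have sum_eq: "(\<Sum>l | l < t \<and> fst (h l) = i. snd (h l)) =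
      (\<Sum>l<t. if fst (h l) = i then snd (h l) else 0)" for h :: "nat \<Rightarrow> nat \<times> real" and i
    by (simp add: sum.If_cases Collect_conj_eq lessThan_def)
  have count [measurable]: "(\<lambda>h. pull_count t h i) \<in> ?H \<rightarrow>\<^sub>M count_space UNIV" for i
    unfolding count_eq by (intro measurable_sum_nat measurable_If) auto
  have mean: "(\<lambda>h. empirical_mean t h i) \<in> borel_measurable ?H" for i
    unfolding empirical_mean_def sum_eq
    by (intro borel_measurable_divide borel_measurable_sum measurable_If borel_measurable_add) auto
  have bounds: "empirical_mean t h i \<in> {0..1}" if h: "h \<in> space ?H" for h i
  proof -
    have r: "0 \<le> snd (h l)" "snd (h l) \<le> 1" if "l < t" for l
      using h that
      by (auto simp: space_PiM PiE_iff round_space_def reward_space_def space_pair_measure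
          space_restrict_space dest!: bspec[of _ _ l])
    have "0 \<le> (\<Sum>l | l < t \<and> fst (h l) = i. snd (h l))"
      by (intro sum_nonneg) (use r in auto)
    moreover have "(\<Sum>l | l < t \<and> fst (h l) = i. snd (h l)) \<le> real (pull_count t h i)"
      unfolding pull_count_def using sum_bounded_above[of "{l. l < t \<and> fst (h l) = i}" _ 1] r
      by fastforce
    ultimately show ?thesis
      unfolding empirical_mean_def by (simp add: divide_simps)
  qed
  have "(\<lambda>h. empirical_mean t h i) \<in> ?H \<rightarrow>\<^sub>M restrict_space borel {0..1}" for i
    using mean bounds by (intro measurable_restrict_space2) auto
  then have "(\<lambda>h. (restrict (pull_count t h) {1..N}, restrict (empirical_mean t h) {1..N})) \<in>
      ?H \<rightarrow>\<^sub>M state_space N"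
    unfolding state_space_def by (intro measurable_Pair measurable_restrict count)
  then show ?thesis
    by (simp add: bandit_state_def[abs_def])
qed

lemma admissible_markov_policy:
  assumes "probability_function N Q"
  shows "admissible_policy N (markov_policy N Q)"
  unfolding admissible_policy_def
proof
  fix t :: nat
  let ?H = "PiM {0..<t} (\<lambda>_. round_space N)"
  have Q [measurable]: "(\<lambda>h. Q i (bandit_state N t h)) \<in> borel_measurable ?H" if "i \<in> {1..N}" for i
    using assms that
    by (intro measurable_compose[OF measurable_bandit_state]) (auto simp: probability_function_def)
  have em: "emeasure (markov_policy N Q t h) A = (\<Sum>i\<in>A. ennreal (Q i (bandit_state N t h)))"
    if "A \<subseteq> {1..N}" for A h
    using that unfolding markov_policy_def by (simp add: emeasure_point_measure_finite)
  show "markov_policy N Q t \<in> ?H \<rightarrow>\<^sub>M prob_algebra (count_space {1..N})"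
  proof (rule measurable_prob_algebra_generated[where \<Omega> = "{1..N}" and G = "Pow {1..N}"])
    show "sets (count_space {1..N}) = sigma_sets {1..N} (Pow {1..N})"
      using sets.sigma_sets_eq[of "count_space {1..N}"] by simp
    show "Int_stable (Pow {1..N})"
      by (auto simp: Int_stable_def)
    show "prob_space (markov_policy N Q t h)" if "h \<in> space ?H" for h
    proof
      have S: "bandit_state N t h \<in> space (state_space N)"
        by (rule measurable_space[OF measurable_bandit_state that])
      have "emeasure (markov_policy N Q t h) (space (markov_policy N Q t h)) =
          (\<Sum>i=1..N. ennreal (Q i (bandit_state N t h)))"
        by (simp add: em[symmetric]) (simp add: markov_policy_def space_point_measure)
      also have "\<dots> = ennreal (\<Sum>i=1..N. Q i (bandit_state N t h))"
        using assms S by (intro sum_ennreal) (auto simp: probability_function_def)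
      also have "\<dots> = 1"
        using assms S by (simp add: probability_function_def)
      finally show "emeasure (markov_policy N Q t h) (space (markov_policy N Q t h)) = 1" .
    qed
    show "sets (markov_policy N Q t h) = sets (count_space {1..N})" for h
      by (simp add: markov_policy_def sets_point_measure)
    show "(\<lambda>h. emeasure (markov_policy N Q t h) A) \<in> borel_measurable ?H" if "A \<in> Pow {1..N}" for A
      using that Q by (simp add: em subset_iff)
  qed auto
qed

end

theory Submission
  imports Defs
begin

text \<open>
  Both probabilistic ingredients come from nonnegative products of the rounds with conditional mean
  at most \<open>1\<close>. If arm \<open>i\<close> is not pulled after time \<open>s\<close>, its own state is frozen, so recurrence
  (transported to arm \<open>i\<close> by anonymity) keeps its pulling probabilities \<open>q\<close> bounded away from \<open>0\<close>; the
  product of the factors \<open>e\<^sup>q\<close>, killed when arm \<open>i\<close> is pulled, would then diverge, which by Fatou's lemma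
  has probability \<open>0\<close>. So every arm is pulled infinitely often. Conversely, Hoeffding's lemma makes the
  exponential of the centred rewards of arm \<open>i\<close> such a product, and Markov's inequality bounds the
  probability that arm \<open>i\<close> has at least \<open>K\<close> samples but a bad empirical mean by an exponential in \<open>K\<close>,
  uniformly in time. Hence with probability close to \<open>1\<close> all counts are large and the empirical means
  are separated, where leading-arm convergence applies.
\<close>

section \<open>The bandit process round by round\<close>

text \<open>The policy is an arbitrary admissible one, because the upper bound on the long-run
  average is later applied to every competitor.\<close>

locale bandit =
  fixes N :: nat and \<Theta> :: "nat \<Rightarrow> real measure"
    and \<pi> :: "nat \<Rightarrow> (nat \<Rightarrow> nat \<times> real) \<Rightarrow> nat measure"
  assumes inst: "bandit_instance N \<Theta>" and adm: "admissible_policy N \<pi>"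
begin

abbreviation "R \<equiv> round_space N"
abbreviation "H t \<equiv> PiM {0..<t} (\<lambda>_. round_space N)"
abbreviation "M \<equiv> bandit_process N \<Theta> \<pi>"
abbreviation hist :: "nat \<Rightarrow> (nat \<Rightarrow> nat \<times> real) \<Rightarrow> nat \<Rightarrow> nat \<times> real" where
  "hist t \<omega> \<equiv> restrict \<omega> {0..<t}"
text \<open>Valued in \<open>ennreal\<close>, so that it serves as a weight inside
  \<open>nn_integral\<close> without integrability conditions.\<close>

definition choice_prob :: "nat \<Rightarrow> (nat \<Rightarrow> nat \<times> real) \<Rightarrow> nat \<Rightarrow> ennreal" where
  "choice_prob t h i = emeasure (\<pi> t h) {i}"

sublocale IT: Ionescu_Tulcea "bandit_step N \<Theta> \<pi>" "\<lambda>_. round_space N"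
  by (rule Ionescu_Tulcea_bandit_step[OF inst adm])

section \<open>Marginals of the trajectory law\<close>

lemma sets_M [measurable_cong]: "sets M = sets (PiM UNIV (\<lambda>_. R))"
  unfolding bandit_process_def by (rule IT.PF.sets_lim)

lemma space_M: "space M = space (PiM UNIV (\<lambda>_. R))"
  by (rule sets_eq_imp_space_eq[OF sets_M])

lemma measurable_hist [measurable]: "hist t \<in> M \<rightarrow>\<^sub>M H t"
  unfolding measurable_cong_sets[OF sets_M refl] by (rule measurable_restrict_subset) simp

lemma measurable_component_M [measurable]: "(\<lambda>\<omega>. \<omega> t) \<in> M \<rightarrow>\<^sub>M R"
  unfolding measurable_cong_sets[OF sets_M refl] by (rule measurable_component_singleton) simp

text \<open>Ties the projective limit in \<open>bandit_process\<close> to finite compositions of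
  step kernels: composing the first \<open>t\<close> kernels from the empty history gives the law of
  the first \<open>t\<close> rounds. The limit is accessed through its finite-dimensional marginals
  \<open>IT.CI\<close>.\<close>

lemma IT_C_eq_distr: "IT.C 0 t (\<lambda>_. undefined) = distr M (H t) (hist t)"
proof -
  \<comment> \<open>\<open>IT.up_to\<close> gives the least horizon beyond which the index set has
    no element; on an initial segment the restriction in \<open>IT.CI\<close> is therefore the
    identity.\<close>
  have "IT.up_to {0..<t} = t"
    unfolding IT.up_to_def by (rule Least_equality) (auto simp: not_less_eq_eq[symmetric])
  then have "IT.CI {0..<t} = distr (IT.C 0 t (\<lambda>_. undefined)) (H t) (hist t)"
    by (simp add: IT.CI_def)
  also have "\<dots> = IT.C 0 t (\<lambda>_. undefined)"
    using IT.distr_C[of t t "\<lambda>_. undefined" 0] by simp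
  finally show ?thesis
    unfolding bandit_process_def by (subst IT.distr_lim) auto
qed

text \<open>A push-forward preserves total mass, so it suffices to look at the marginal at time
  \<open>0\<close>.\<close>

lemma prob_space_M: "prob_space M"
proof -
  have "prob_space (distr M (H 0) (hist 0))"
    unfolding IT_C_eq_distr[symmetric] by (rule IT.prob_space_C) simp
  then show ?thesis
    by (rule prob_space_distrD[OF measurable_hist])
qed

sublocale prob_space M
  by (rule prob_space_M)

text \<open>Disintegration at round \<open>t\<close>: the law of \<open>Suc t\<close> rounds is the
  law of \<open>t\<close> rounds followed by the kernel \<open>IT.eP t\<close>, which appends a draw
  from \<open>bandit_step\<close>. The past and the new round are separate arguments of
  \<open>f\<close>, so that the inner integral holds the past fixed.\<close>

lemma nn_integral_round:
  assumes f: "case_prod f \<in> borel_measurable (H t \<Otimes>\<^sub>M R)"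
  shows "(\<integral>\<^sup>+\<omega>. f (hist t \<omega>) (\<omega> t) \<partial>M) =
    (\<integral>\<^sup>+\<omega>. (\<integral>\<^sup>+y. f (hist t \<omega>) y \<partial>bandit_step N \<Theta> \<pi> t (hist t \<omega>)) \<partial>M)"
proof -
  note [measurable] = f
  define F where "F h = f (restrict h {0..<t}) (h t)" for h
  have [measurable]: "(\<lambda>h. h t) \<in> H (Suc t) \<rightarrow>\<^sub>M R"
    by (intro measurable_component_singleton) auto
  have [measurable]: "(\<lambda>h. restrict h {0..<t}) \<in> H (Suc t) \<rightarrow>\<^sub>M H t"
    by (intro measurable_restrict_subset) auto
  have F [measurable]: "F \<in> borel_measurable (H (Suc t))"
    unfolding F_def by measurable
  have bs [measurable]: "bandit_step N \<Theta> \<pi> t \<in> H t \<rightarrow>\<^sub>M subprob_algebra R"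
    by (rule IT.P)
  have "(\<integral>\<^sup>+\<omega>. f (hist t \<omega>) (\<omega> t) \<partial>M) = (\<integral>\<^sup>+\<omega>. F (hist (Suc t) \<omega>) \<partial>M)"
    by (intro nn_integral_cong) (simp add: F_def Int_absorb1 restrict_restrict)
  also have "\<dots> = (\<integral>\<^sup>+h. F h \<partial>distr M (H (Suc t)) (hist (Suc t)))"
    by (simp add: nn_integral_distr[OF measurable_hist] F)
  also have "\<dots> = (\<integral>\<^sup>+h. F h \<partial>(IT.C 0 t (\<lambda>_. undefined) \<bind> IT.eP t))"
    by (simp add: IT_C_eq_distr[symmetric])
  also have "\<dots> = (\<integral>\<^sup>+h. \<integral>\<^sup>+h'. F h' \<partial>IT.eP t h \<partial>IT.C 0 t (\<lambda>_. undefined))"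
    by (rule nn_integral_bind[OF F])
       (simp add: IT.measurable_eP measurable_cong_sets[OF IT.sets_C refl])
  also have "\<dots> = (\<integral>\<^sup>+h. \<integral>\<^sup>+y. f h y \<partial>bandit_step N \<Theta> \<pi> t h \<partial>IT.C 0 t (\<lambda>_. undefined))"
  proof (intro nn_integral_cong)
    fix h assume "h \<in> space (IT.C 0 t (\<lambda>_. undefined))"
    then have h: "h \<in> space (H t)"
      by (simp add: IT.space_C)
    then have "restrict (h(t := y)) {0..<t} = h" for y
      by (simp add: space_PiM PiE_iff extensional_def fun_eq_iff)
    then show "(\<integral>\<^sup>+h'. F h' \<partial>IT.eP t h) = (\<integral>\<^sup>+y. f h y \<partial>bandit_step N \<Theta> \<pi> t h)"
      unfolding IT.nn_integral_eP[OF h F] by (simp add: F_def)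
  qed
  also have "\<dots> = (\<integral>\<^sup>+\<omega>. (\<integral>\<^sup>+y. f (hist t \<omega>) y \<partial>bandit_step N \<Theta> \<pi> t (hist t \<omega>)) \<partial>M)"
    unfolding IT_C_eq_distr
    by (subst nn_integral_distr) (auto intro!: nn_integral_measurable_subprob_algebra2[where N = R])
  finally show ?thesis .
qed

section \<open>Integrals over a single round\<close>

lemma prob_algebra_\<Theta>: "i \<in> {1..N} \<Longrightarrow> \<Theta> i \<in> space (prob_algebra reward_space)"
  using inst by (auto simp: bandit_instance_def)

lemma sets_\<Theta>: "i \<in> {1..N} \<Longrightarrow> sets (\<Theta> i) = sets reward_space"
  using prob_algebra_\<Theta> by (auto simp: space_prob_algebra)

lemma prob_space_\<Theta>: "i \<in> {1..N} \<Longrightarrow> prob_space (\<Theta> i)"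
  using prob_algebra_\<Theta> by (auto simp: space_prob_algebra)

lemma space_\<Theta>: "i \<in> {1..N} \<Longrightarrow> space (\<Theta> i) = {0..1}"
  using sets_eq_imp_space_eq[OF sets_\<Theta>] by (simp add: reward_space_def space_restrict_space)

lemma policy:
  assumes h: "h \<in> space (H t)"
  shows "prob_space (\<pi> t h)" "sets (\<pi> t h) = Pow {1..N}" "space (\<pi> t h) = {1..N}"
proof -
  have *: "\<pi> t h \<in> space (prob_algebra (count_space {1..N}))"
    using adm by (intro measurable_space[OF _ h]) (simp add: admissible_policy_def)
  show "prob_space (\<pi> t h)" "sets (\<pi> t h) = Pow {1..N}" 
    using * by (simp_all add: space_prob_algebra)
  then show "space (\<pi> t h) = {1..N}"
    by (metis sets_eq_imp_space_eq sets_count_space space_count_space)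
qed

lemma sum_choice_prob:
  assumes h: "h \<in> space (H t)"
  shows "(\<Sum>i=1..N. choice_prob t h i) = 1"
proof -
  interpret P: prob_space "\<pi> t h"
    by (rule policy[OF h])
  have "(\<Sum>i\<in>{1..N}. emeasure (\<pi> t h) {i}) = emeasure (\<pi> t h) {1..N}"
    by (rule emeasure_eq_sum_singleton[symmetric]) (auto simp: policy[OF h])
  with P.emeasure_space_1 show ?thesis
    by (simp add: choice_prob_def policy[OF h])
qed

lemma measurable_choice_prob [measurable]: 
  assumes "i \<in> {1..N}"
  shows "(\<lambda>h. choice_prob t h i) \<in> borel_measurable (H t)"
proof -
  have "\<pi> t \<in> H t \<rightarrow>\<^sub>M subprob_algebra (count_space {1..N})"
    using adm by (auto simp: admissible_policy_def intro: measurable_prob_algebraD)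
  moreover have "{i} \<in> sets (count_space {1..N})"
    using assms by simp
  ultimately show ?thesis
    unfolding choice_prob_def by (rule measurable_compose[OF _ measurable_emeasure_subprob_algebra])
qed

text \<open>Both binds are integrated out in turn. The arms form a finite discrete space, so
  measurability in the arm is automatic and the outer integral is a finite sum.\<close>

lemma nn_integral_bandit_step:
  assumes h: "h \<in> space (H t)" and f: "f \<in> borel_measurable R"
  shows "(\<integral>\<^sup>+y. f y \<partial>bandit_step N \<Theta> \<pi> t h) =
    (\<Sum>i=1..N. choice_prob t h i * (\<integral>\<^sup>+r. f (i, r) \<partial>\<Theta> i))"
proof -
  let ?K = "\<lambda>i. \<Theta> i \<bind> (\<lambda>r. return R (i, r))"
  have m: "(\<lambda>r. return R (i, r)) \<in> \<Theta> i \<rightarrow>\<^sub>M subprob_algebra R" if i: "i \<in> {1..N}" for i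
  proof -
    have "Pair i \<in> reward_space \<rightarrow>\<^sub>M R"
      unfolding round_space_def using i by (intro measurable_Pair1') simp
    then show ?thesis
      by (intro measurable_compose[OF _ return_measurable])
         (simp add: measurable_cong_sets[OF sets_\<Theta>[OF i] refl])
  qed
  have pair: "(i, r) \<in> space R" if "i \<in> {1..N}" "r \<in> space (\<Theta> i)" for i r
    using that sets_eq_imp_space_eq[OF sets_\<Theta>] by (simp add: round_space_def space_pair_measure)
  have "?K i \<in> space (subprob_algebra R)" if i: "i \<in> {1..N}" for i
  proof -
    interpret Ti: prob_space "\<Theta> i" by (rule prob_space_\<Theta>[OF i])
    show ?thesis
      by (rule Ti.bind_in_space[OF m[OF i]])
  qed
  then have K: "?K \<in> \<pi> t h \<rightarrow>\<^sub>M subprob_algebra R"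
    by (subst measurable_cong_sets[where M' = "count_space {1..N}", OF _ refl])
       (simp_all add: Pi_iff policy(2)[OF h])
  have "(\<integral>\<^sup>+y. f y \<partial>bandit_step N \<Theta> \<pi> t h) = (\<integral>\<^sup>+i. \<integral>\<^sup>+y. f y \<partial>?K i \<partial>\<pi> t h)"
    unfolding bandit_step_def by (rule nn_integral_bind[OF f K])
  also have "\<dots> = (\<integral>\<^sup>+i. \<integral>\<^sup>+r. f (i, r) \<partial>\<Theta> i \<partial>\<pi> t h)"
  proof (intro nn_integral_cong)
    fix i assume "i \<in> space (\<pi> t h)"
    then have i: "i \<in> {1..N}" by (simp add: policy[OF h])
    have "(\<integral>\<^sup>+y. f y \<partial>?K i) = (\<integral>\<^sup>+r. \<integral>\<^sup>+y. f y \<partial>return R (i, r) \<partial>\<Theta> i)"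
      by (rule nn_integral_bind[OF f m[OF i]])
    also have "\<dots> = (\<integral>\<^sup>+r. f (i, r) \<partial>\<Theta> i)"
      using pair[OF i] f by (intro nn_integral_cong) (simp add: nn_integral_return)
    finally show "(\<integral>\<^sup>+y. f y \<partial>?K i) = (\<integral>\<^sup>+r. f (i, r) \<partial>\<Theta> i)" .
  qed
  also have "\<dots> = (\<Sum>i=1..N. (\<integral>\<^sup>+r. f (i, r) \<partial>\<Theta> i) * choice_prob t h i)"
  proof -
    \<comment> \<open>On the finite arm set a function is the sum of its values times singleton
      indicators.\<close>
    have *: "(\<integral>\<^sup>+i. g i \<partial>\<pi> t h) = (\<Sum>i=1..N. g i * choice_prob t h i)" for g :: "nat \<Rightarrow> ennreal"
    proof -
      have "(\<integral>\<^sup>+i. g i \<partial>\<pi> t h) = (\<integral>\<^sup>+i. (\<Sum>j=1..N. g j * indicator {j} i) \<partial>\<pi> t h)"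
        by (intro nn_integral_cong) (auto simp: policy[OF h] indicator_def if_distrib sum.delta cong: if_cong)
      also have "\<dots> = (\<Sum>j=1..N. g j * choice_prob t h j)"
        by (subst nn_integral_sum)
           (auto simp: choice_prob_def policy[OF h] nn_integral_cmult_indicator
             intro!: sum.cong borel_measurable_times_ennreal borel_measurable_indicator)
      finally show ?thesis .
    qed
    show ?thesis by (rule *)
  qed
  finally show ?thesis
    by (simp add: mult.commute)
qed

lemma hist_space: "\<omega> \<in> space M \<Longrightarrow> hist t \<omega> \<in> space (H t)"
  by (auto simp: space_M space_PiM PiE_iff)

lemma nn_integral_step:
  assumes f: "case_prod f \<in> borel_measurable (H t \<Otimes>\<^sub>M R)"
  shows "(\<integral>\<^sup>+\<omega>. f (hist t \<omega>) (\<omega> t) \<partial>M) =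
    (\<integral>\<^sup>+\<omega>. (\<Sum>i=1..N. choice_prob t (hist t \<omega>) i * (\<integral>\<^sup>+r. f (hist t \<omega>) (i, r) \<partial>\<Theta> i)) \<partial>M)"
  unfolding nn_integral_round[OF f]
proof (intro nn_integral_cong nn_integral_bandit_step)
  fix \<omega> assume "\<omega> \<in> space M"
  then show h: "hist t \<omega> \<in> space (H t)" by (rule hist_space)
  show "f (hist t \<omega>) \<in> borel_measurable R"
    using measurable_compose[OF measurable_Pair1'[OF h] f] by simp
qed

text \<open>The partial products form a nonnegative supermartingale started at \<open>1\<close>.
  With the conditional means written out as sums over arms, neither a filtration nor integrability
  has to be set up. Both the deviation bound and the argument against abandoned arms are
  instances.\<close>

lemma nn_integral_prod_le_1:
  assumes g: "\<And>l. case_prod (g l) \<in> borel_measurable (H l \<Otimes>\<^sub>M R)"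
    and le: "\<And>l h. h \<in> space (H l) \<Longrightarrow>
      (\<Sum>i=1..N. choice_prob l h i * (\<integral>\<^sup>+r. g l h (i, r) \<partial>\<Theta> i)) \<le> 1"
  shows "(\<integral>\<^sup>+\<omega>. (\<Prod>l<t. g l (hist l \<omega>) (\<omega> l)) \<partial>M) \<le> 1"
proof (induction t)
  case 0
  then show ?case by (simp add: emeasure_space_1)
next
  case (Suc t)
  \<comment> \<open>The product of the first \<open>t\<close> factors reads only the first
    \<open>t\<close> rounds, so it is a constant in the conditional mean of round \<open>t\<close>
    and can be pulled out.\<close>
  define W where "W h = (\<Prod>l<t. g l (hist l h) (h l))" for h
  have W_hist: "W (hist t \<omega>) = W \<omega>" for \<omega>
    unfolding W_def by (intro prod.cong refl) (auto simp: Int_absorb1)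
  have W: "W \<in> borel_measurable (H t)"
    unfolding W_def
  proof (intro borel_measurable_prod_ennreal)
    fix l assume "l \<in> {..<t}"
    then have l: "l < t" by simp
    have "(\<lambda>h. (hist l h, h l)) \<in> H t \<rightarrow>\<^sub>M H l \<Otimes>\<^sub>M R"
      using l by (intro measurable_Pair measurable_restrict_subset measurable_component_singleton) auto
    from measurable_compose[OF this g] show "(\<lambda>h. g l (hist l h) (h l)) \<in> borel_measurable (H t)"
      by simp
  qed
  note [measurable] = W g[of t]
  have "(\<integral>\<^sup>+\<omega>. (\<Prod>l<Suc t. g l (hist l \<omega>) (\<omega> l)) \<partial>M) =
      (\<integral>\<^sup>+\<omega>. W (hist t \<omega>) * g t (hist t \<omega>) (\<omega> t) \<partial>M)"
    by (simp add: W_hist) (simp add: W_def)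
  also have "\<dots> = (\<integral>\<^sup>+\<omega>. (\<Sum>i=1..N. choice_prob t (hist t \<omega>) i *
      (\<integral>\<^sup>+r. W (hist t \<omega>) * g t (hist t \<omega>) (i, r) \<partial>\<Theta> i)) \<partial>M)"
    by (rule nn_integral_step) measurable
  also have "\<dots> \<le> (\<integral>\<^sup>+\<omega>. W (hist t \<omega>) \<partial>M)"
  proof (intro nn_integral_mono)
    fix \<omega> assume "\<omega> \<in> space M"
    then have h: "hist t \<omega> \<in> space (H t)" by (rule hist_space)
    let ?h = "hist t \<omega>"
    have gm: "(\<lambda>r. g t ?h (i, r)) \<in> borel_measurable (\<Theta> i)" if i: "i \<in> {1..N}" for i
    proof -
      have "Pair i \<in> reward_space \<rightarrow>\<^sub>M R"
        unfolding round_space_def using i by (intro measurable_Pair1') simp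
      then have "Pair i \<in> \<Theta> i \<rightarrow>\<^sub>M R"
        by (simp add: measurable_cong_sets[OF sets_\<Theta>[OF i] refl])
      from measurable_compose[OF measurable_compose[OF this measurable_Pair1'[OF h]] g[of t]]
      show ?thesis by simp
    qed
    have "(\<Sum>i=1..N. choice_prob t ?h i * (\<integral>\<^sup>+r. W ?h * g t ?h (i, r) \<partial>\<Theta> i)) =
       (\<Sum>i=1..N. W ?h * (choice_prob t ?h i * (\<integral>\<^sup>+r. g t ?h (i, r) \<partial>\<Theta> i)))"
      by (intro sum.cong refl) (simp add: nn_integral_cmult gm mult_ac)
    also have "\<dots> = W ?h * (\<Sum>i=1..N. choice_prob t ?h i * (\<integral>\<^sup>+r. g t ?h (i, r) \<partial>\<Theta> i))"
      by (simp add: sum_distrib_left)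
    also have "\<dots> \<le> W ?h * 1"
      by (intro mult_left_mono le[OF h]) simp
    finally show "(\<Sum>i=1..N. choice_prob t ?h i * (\<integral>\<^sup>+r. W ?h * g t ?h (i, r) \<partial>\<Theta> i)) \<le> W ?h"
      by simp
  qed
  also have "\<dots> \<le> 1"
    unfolding W_hist unfolding W_def by (rule Suc.IH)
  finally show ?case .
qed

section \<open>Deviations of the empirical means\<close>

lemma measurable_fst_R: "fst \<in> R \<rightarrow>\<^sub>M count_space {1..N}"
  unfolding round_space_def by (rule measurable_fst)

lemma measurable_action: "(\<lambda>\<omega>. fst (\<omega> t)) \<in> M \<rightarrow>\<^sub>M count_space {1..N}"
  by (rule measurable_compose[OF measurable_component_M measurable_fst_R])

lemma measurable_action_eq [measurable]: "Measurable.pred M (\<lambda>\<omega>. fst (\<omega> t) = i)"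
  by (rule measurable_compose[OF measurable_action]) simp

lemma measurable_snd_R [measurable]: "snd \<in> borel_measurable R"
proof -
  have "snd \<in> R \<rightarrow>\<^sub>M reward_space"
    unfolding round_space_def by (rule measurable_snd)
  then show ?thesis
    unfolding reward_space_def by (simp add: measurable_restrict_space2_iff)
qed

lemma measurable_fst_eq_R [measurable]: "Measurable.pred R (\<lambda>y. fst y = i)"
  by (rule measurable_compose[OF measurable_fst_R]) simp

lemma reward_bounds:
  assumes "\<omega> \<in> space M"
  shows "0 \<le> snd (\<omega> t)" "snd (\<omega> t) \<le> 1"
  using assms
  by (auto simp: space_M space_PiM PiE_iff round_space_def reward_space_def space_pair_measure
      space_restrict_space mem_Times_iff)

text \<open>The state at time \<open>t\<close> reads only rounds before \<open>t\<close>. Hence it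
  can be evaluated on whole trajectories, where events at different times live on one space.\<close>

lemma bandit_state_hist: "bandit_state N t (hist t \<omega>) = bandit_state N t \<omega>"
  by (auto simp: bandit_state_def pull_count_def empirical_mean_def fun_eq_iff
      intro!: arg_cong[where f = card] arg_cong2[where f = "(/)"] sum.cong)

lemma measurable_bandit_state_M: "bandit_state N t \<in> M \<rightarrow>\<^sub>M state_space N"
  using measurable_compose[OF measurable_hist measurable_bandit_state] by (simp add: bandit_state_hist)

lemma measurable_pull_count: 
  assumes "i \<in> {1..N}"
  shows "(\<lambda>\<omega>. pull_count t \<omega> i) \<in> M \<rightarrow>\<^sub>M count_space UNIV"
proof -
  have "(\<lambda>\<omega>. fst (bandit_state N t \<omega>) i) \<in> M \<rightarrow>\<^sub>M count_space UNIV"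
    using measurable_compose[OF measurable_compose[OF measurable_bandit_state_M[unfolded state_space_def]
      measurable_fst] measurable_component_singleton[OF assms]] .
  then show ?thesis
    using assms by (simp add: bandit_state_def)
qed

lemma measurable_empirical_mean:
  assumes "i \<in> {1..N}"
  shows "(\<lambda>\<omega>. empirical_mean t \<omega> i) \<in> borel_measurable M"
proof -
  have "(\<lambda>\<omega>. snd (bandit_state N t \<omega>) i) \<in> M \<rightarrow>\<^sub>M restrict_space borel {0..1}"
    using measurable_compose[OF measurable_compose[OF measurable_bandit_state_M[unfolded state_space_def]
      measurable_snd] measurable_component_singleton[OF assms]] .
  then show ?thesis
    using assms by (simp add: bandit_state_def measurable_restrict_space2_iff)
qed

lemma arm_mean:
  assumes i: "i \<in> {1..N}"
  shows "(\<integral>\<^sup>+r. ennreal r \<partial>\<Theta> i) = ennreal (arm_mean \<Theta> i)" "0 \<le> arm_mean \<Theta> i" "arm_mean \<Theta> i \<le> 1"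
    "(\<lambda>r. r) \<in> borel_measurable (\<Theta> i)"
proof -
  interpret Ti: prob_space "\<Theta> i" by (rule prob_space_\<Theta>[OF i])
  show [measurable]: "(\<lambda>r. r) \<in> borel_measurable (\<Theta> i)"
    unfolding measurable_cong_sets[OF sets_\<Theta>[OF i] refl] reward_space_def
    by (rule measurable_restrict_space1) simp
  have b: "AE r in \<Theta> i. 0 \<le> r \<and> r \<le> 1"
    by (rule AE_I2) (simp add: space_\<Theta>[OF i])
  have int: "integrable (\<Theta> i) (\<lambda>r. r)"
    by (rule Ti.integrable_const_bound[of _ 1]) (use b in auto)
  show "(\<integral>\<^sup>+r. ennreal r \<partial>\<Theta> i) = ennreal (arm_mean \<Theta> i)"
    unfolding arm_mean_def by (rule nn_integral_eq_integral[OF int]) (use b in auto)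
  show "0 \<le> arm_mean \<Theta> i"
    unfolding arm_mean_def by (rule integral_nonneg_AE) (use b in auto)
  show "arm_mean \<Theta> i \<le> 1"
    unfolding arm_mean_def by (rule Ti.integral_le_const[OF int]) (use b in auto)
qed

text \<open>Hoeffding's lemma for a centred variable whose range has length \<open>1\<close>,
  divided by its bound \<open>exp (l\<^sup>2 / 8)\<close>. The sign \<open>c\<close> covers both
  tails.\<close>

lemma mgf_le:
  assumes i: "i \<in> {1..N}" and c: "\<bar>c\<bar> = 1" and l: "0 < l"
  shows "(\<integral>\<^sup>+r. ennreal (exp (l * (c * (r - arm_mean \<Theta> i)) - l\<^sup>2 / 8)) \<partial>\<Theta> i) \<le> 1"
proof -
  interpret Ti: prob_space "\<Theta> i" by (rule prob_space_\<Theta>[OF i])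
  note [measurable] = arm_mean(4)[OF i]
  let ?\<mu> = "arm_mean \<Theta> i"
  have b: "AE r in \<Theta> i. 0 \<le> r \<and> r \<le> 1"
    by (rule AE_I2) (simp add: space_\<Theta>[OF i])
  have int: "integrable (\<Theta> i) (\<lambda>r. r)"
    by (rule Ti.integrable_const_bound[of _ 1]) (use b in auto)
  \<comment> \<open>Left end of the range of \<open>c * (r - ?\<mu>)\<close> for \<open>r\<close> in
    the unit interval; the right end is \<open>a + 1\<close> for either sign.\<close>
  define a where "a = (if c = 1 then - ?\<mu> else ?\<mu> - 1)"
  have cc: "c = 1 \<or> c = -1" using c by (auto simp: abs_if split: if_splits)
  interpret I: interval_bounded_random_variable "\<Theta> i" "\<lambda>r. c * (r - ?\<mu>)" a "a + 1"
  proof unfold_locales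
    show "(\<lambda>r. c * (r - ?\<mu>)) \<in> borel_measurable (\<Theta> i)"
      by measurable
    show "AE r in \<Theta> i. c * (r - ?\<mu>) \<in> {a..a + 1}"
      by (rule eventually_mono[OF b]) (use cc in \<open>auto simp: a_def\<close>)
  qed
  have "Ti.expectation (\<lambda>r. c * (r - ?\<mu>)) = 0"
    using int by (simp add: arm_mean_def Ti.prob_space)
  from I.Hoeffdings_lemma_nn_integral_0[OF l this]
  have H: "(\<integral>\<^sup>+r. ennreal (exp (l * (c * (r - ?\<mu>)))) \<partial>\<Theta> i) \<le> ennreal (exp (l\<^sup>2 / 8))"
    by simp
  have "(\<integral>\<^sup>+r. ennreal (exp (l * (c * (r - ?\<mu>)) - l\<^sup>2 / 8)) \<partial>\<Theta> i) =
      (\<integral>\<^sup>+r. ennreal (exp (- (l\<^sup>2 / 8))) * ennreal (exp (l * (c * (r - ?\<mu>)))) \<partial>\<Theta> i)"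
    by (simp add: ennreal_mult[symmetric] exp_add[symmetric] algebra_simps)
  also have "\<dots> = ennreal (exp (- (l\<^sup>2 / 8))) * (\<integral>\<^sup>+r. ennreal (exp (l * (c * (r - ?\<mu>)))) \<partial>\<Theta> i)"
    by (rule nn_integral_cmult) measurable
  also have "\<dots> \<le> ennreal (exp (- (l\<^sup>2 / 8))) * ennreal (exp (l\<^sup>2 / 8))"
    by (rule mult_left_mono[OF H]) simp
  also have "\<dots> = 1"
    by (simp add: ennreal_mult[symmetric] exp_add[symmetric])
  finally show ?thesis .
qed

text \<open>
  The number of samples is random, so the exponential is tilted by \<open>\<lambda> = 4 * \<delta>\<close>, the maximizer of
  \<open>\<lambda> * \<delta> - \<lambda>\<^sup>2 / 8\<close>, and not by a parameter depending on it. The condition \<open>1 \<le> \<delta> * K\<close> absorbs the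
  bias of \<open>empirical_mean\<close>, whose denominator is the number of samples plus one.
\<close>

lemma one_sided_deviation:
  assumes i: "i \<in> {1..N}" and c: "\<bar>c\<bar> = 1" and \<delta>: "0 < \<delta>" "1 \<le> \<delta> * real K"
  shows "prob {\<omega>\<in>space M. K \<le> pull_count t \<omega> i \<and>
      2 * \<delta> \<le> c * (empirical_mean t \<omega> i - arm_mean \<Theta> i)} \<le> exp (- 2 * \<delta>\<^sup>2 * real K)"
proof -
  note [measurable] = measurable_pull_count[OF i] measurable_empirical_mean[OF i]
  let ?\<mu> = "arm_mean \<Theta> i"
  define x where "x y = 4 * \<delta> * (c * (snd y - ?\<mu>)) - (4 * \<delta>)\<^sup>2 / 8" for y :: "nat \<times> real"
  \<comment> \<open>Rounds of other arms contribute the factor \<open>1\<close>, so the product has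
    exactly one exponential per sample of arm \<open>i\<close>.\<close>
  define g where "g l h y = (if fst y = i then ennreal (exp (x y)) else 1)"
    for l :: nat and h :: "nat \<Rightarrow> nat \<times> real" and y :: "nat \<times> real"
  let ?A = "{\<omega>\<in>space M. K \<le> pull_count t \<omega> i \<and>
      2 * \<delta> \<le> c * (empirical_mean t \<omega> i - ?\<mu>)}"
  have [measurable]: "x \<in> borel_measurable R"
    unfolding x_def by measurable
  have le1: "(\<integral>\<^sup>+\<omega>. (\<Prod>l<t. g l (hist l \<omega>) (\<omega> l)) \<partial>M) \<le> 1"
  proof (rule nn_integral_prod_le_1)
    show "case_prod (g l) \<in> borel_measurable (H l \<Otimes>\<^sub>M R)" for l
      unfolding g_def by measurable
  next
    fix l :: nat and h assume h: "h \<in> space (H l)"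
    have "(\<Sum>j=1..N. choice_prob l h j * (\<integral>\<^sup>+r. g l h (j, r) \<partial>\<Theta> j)) \<le>
        (\<Sum>j=1..N. choice_prob l h j * 1)"
    proof (intro sum_mono mult_left_mono)
      fix j assume j: "j \<in> {1..N}"
      then interpret Tj: prob_space "\<Theta> j" by (rule prob_space_\<Theta>)
      show "(\<integral>\<^sup>+r. g l h (j, r) \<partial>\<Theta> j) \<le> 1"
        using mgf_le[OF i c, of "4 * \<delta>"] \<delta>
        by (cases "j = i") (simp_all add: g_def x_def Tj.emeasure_space_1)
    qed simp
    then show "(\<Sum>j=1..N. choice_prob l h j * (\<integral>\<^sup>+r. g l h (j, r) \<partial>\<Theta> j)) \<le> 1"
      using sum_choice_prob[OF h] by simp
  qed
  \<comment> \<open>With \<open>k\<close> samples the event forces a centred sum of at least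
    \<open>\<delta> * k\<close>, so the exponent is at least
    \<open>4 * \<delta>\<^sup>2 * k - 2 * \<delta>\<^sup>2 * k\<close>, and \<open>k\<close> is at
    least \<open>K\<close>.\<close>
  have big: "ennreal (exp (2 * \<delta>\<^sup>2 * real K)) \<le> (\<Prod>l<t. g l (hist l \<omega>) (\<omega> l))" if \<omega>: "\<omega> \<in> ?A" for \<omega>
  proof -
    define k where "k = real (pull_count t \<omega> i)"
    let ?L = "{l. l < t \<and> fst (\<omega> l) = i}"
    have fin: "finite ?L" by simp
    have k: "real K \<le> k" "real (card ?L) = k" using \<omega> by (auto simp: k_def pull_count_def)
    have m: "(\<Sum>l\<in>?L. snd (\<omega> l)) = empirical_mean t \<omega> i * (k + 1)"
      using k by (simp add: empirical_mean_def k_def)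
    have "(\<Prod>l<t. g l (hist l \<omega>) (\<omega> l)) = (\<Prod>l\<in>?L. ennreal (exp (x (\<omega> l))))"
      unfolding g_def by (simp add: prod.If_cases Collect_conj_eq lessThan_def)
    also have "\<dots> = ennreal (exp (\<Sum>l\<in>?L. x (\<omega> l)))"
      using fin by (simp add: prod_ennreal exp_sum)
    also have "(\<Sum>l\<in>?L. x (\<omega> l)) = 4 * \<delta> * (c * ((\<Sum>l\<in>?L. snd (\<omega> l)) - k * ?\<mu>)) - k * (2 * \<delta>\<^sup>2)"
      by (simp add: x_def sum_subtractf sum_distrib_left[symmetric] k(2) power2_eq_square)
    \<comment> \<open>The denominator \<open>k + 1\<close> of the empirical mean leaves one surplus
      \<open>?\<mu>\<close> after centring \<open>k\<close> samples.\<close>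
    also have "(\<Sum>l\<in>?L. snd (\<omega> l)) - k * ?\<mu> = (empirical_mean t \<omega> i - ?\<mu>) * (k + 1) + ?\<mu>"
      unfolding m by (simp add: algebra_simps)
    finally have eq: "(\<Prod>l<t. g l (hist l \<omega>) (\<omega> l)) = ennreal (exp (4 * \<delta> *
        (c * ((empirical_mean t \<omega> i - ?\<mu>) * (k + 1) + ?\<mu>)) - k * (2 * \<delta>\<^sup>2)))" .
    have "\<delta> * k \<ge> 1"
      using \<delta> k mult_left_mono[of "real K" k \<delta>] by linarith
    have "2 * \<delta> * (k + 1) \<le> c * (empirical_mean t \<omega> i - ?\<mu>) * (k + 1)"
      using \<omega> by (intro mult_right_mono) (auto simp: k_def)
    \<comment> \<open>For \<open>c = -1\<close> the surplus mean is harmful, but it costs at most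
      \<open>1\<close>, which is at most \<open>\<delta> * k\<close>.\<close>
    moreover have "- 1 \<le> c * ?\<mu>"
      using c arm_mean(2,3)[OF i] by (auto simp: abs_if split: if_splits)
    ultimately have "\<delta> * k \<le> c * ((empirical_mean t \<omega> i - ?\<mu>) * (k + 1) + ?\<mu>)"
      using \<open>\<delta> * k \<ge> 1\<close> \<delta> by (simp add: algebra_simps)
    then have "4 * \<delta> * (\<delta> * k) \<le> 4 * \<delta> * (c * ((empirical_mean t \<omega> i - ?\<mu>) * (k + 1) + ?\<mu>))"
      using \<delta> by (intro mult_left_mono) auto
    moreover have "\<delta>\<^sup>2 * real K \<le> \<delta>\<^sup>2 * k"
      using k by (intro mult_left_mono) auto
    ultimately have "2 * \<delta>\<^sup>2 * real K \<le>
      4 * \<delta> * (c * ((empirical_mean t \<omega> i - ?\<mu>) * (k + 1) + ?\<mu>)) - k * (2 * \<delta>\<^sup>2)"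
      by (simp add: power2_eq_square algebra_simps)
    then show ?thesis
      unfolding eq by (intro ennreal_leI) simp
  qed
  \<comment> \<open>Markov's inequality for the product.\<close>
  have "ennreal (exp (2 * \<delta>\<^sup>2 * real K)) * emeasure M ?A =
      (\<integral>\<^sup>+\<omega>. ennreal (exp (2 * \<delta>\<^sup>2 * real K)) * indicator ?A \<omega> \<partial>M)"
    by (subst nn_integral_cmult_indicator) measurable
  also have "\<dots> \<le> (\<integral>\<^sup>+\<omega>. (\<Prod>l<t. g l (hist l \<omega>) (\<omega> l)) \<partial>M)"
    by (intro nn_integral_mono) (use big in \<open>auto simp: indicator_def\<close>)
  also note le1
  finally have "ennreal (exp (2 * \<delta>\<^sup>2 * real K) * prob ?A) \<le> ennreal 1"
    by (simp add: emeasure_eq_measure ennreal_mult)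
  then have "exp (2 * \<delta>\<^sup>2 * real K) * prob ?A \<le> 1"
    by (simp add: ennreal_le_iff)
  then show ?thesis
    by (simp add: exp_minus field_simps)
qed

text \<open>Union bound over the two signs. The bound does not involve \<open>t\<close>, so
  \<open>K\<close> can be fixed before \<open>t\<close> tends to infinity.\<close>

lemma deviation:
  assumes i: "i \<in> {1..N}" and \<delta>: "0 < \<delta>" "1 \<le> \<delta> * real K"
  shows "prob {\<omega>\<in>space M. K \<le> pull_count t \<omega> i \<and>
      2 * \<delta> \<le> \<bar>empirical_mean t \<omega> i - arm_mean \<Theta> i\<bar>} \<le> 2 * exp (- 2 * \<delta>\<^sup>2 * real K)"
proof -
  note [measurable] = measurable_pull_count[OF i] measurable_empirical_mean[OF i]
  let ?A = "\<lambda>c. {\<omega>\<in>space M. K \<le> pull_count t \<omega> i \<and>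
      2 * \<delta> \<le> c * (empirical_mean t \<omega> i - arm_mean \<Theta> i)}"
  have eq: "{\<omega>\<in>space M. K \<le> pull_count t \<omega> i \<and>
      2 * \<delta> \<le> \<bar>empirical_mean t \<omega> i - arm_mean \<Theta> i\<bar>} = ?A 1 \<union> ?A (-1)"
    by (auto simp: abs_if)
  have "prob (?A 1 \<union> ?A (-1)) \<le> prob (?A 1) + prob (?A (-1))"
    by (intro measure_Un_le) measurable
  also have "\<dots> \<le> 2 * exp (- 2 * \<delta>\<^sup>2 * real K)"
    using one_sided_deviation[OF i _ \<delta>, of 1 t] one_sided_deviation[OF i _ \<delta>, of "-1" t] by simp
  finally show ?thesis
    unfolding eq .
qed

section \<open>No arm is abandoned\<close>

text \<open>
  The bound \<open>\<epsilon>\<close> may depend non-measurably on the trajectory; stating the result with \<open>AE\<close>, which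
  only needs a null superset, avoids this issue.
\<close>

lemma AE_not_abandoned:
  assumes i: "i \<in> {1..N}"
  shows "AE \<omega> in M. \<not> ((\<forall>l\<ge>s. fst (\<omega> l) \<noteq> i) \<and>
      (\<exists>\<epsilon>>0. \<forall>l\<ge>s. ennreal \<epsilon> \<le> choice_prob l (hist l \<omega>) i))"
proof -
  note [measurable] = measurable_choice_prob[OF i]
  define q where "q l h = enn2real (choice_prob l h i)" for l :: nat and h
  \<comment> \<open>Rounds before \<open>s\<close> are neutral; from \<open>s\<close> on, a pull of
    arm \<open>i\<close> kills the product.\<close>
  define g where "g l h y = (if l < s then 1 else if fst y = i then 0 else ennreal (exp (q l h)))"
    for l h and y :: "nat \<times> real"
  have choice_le: "choice_prob l h i \<le> 1" if "h \<in> space (H l)" for l h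
    using sum_choice_prob[OF that] member_le_sum[of i "{1..N}" "choice_prob l h"] i by simp
  have q: "ennreal (q l h) = choice_prob l h i" "q l h \<le> 1" if "h \<in> space (H l)" for l h
    unfolding q_def using choice_le[OF that] ennreal_one_less_top
    by (simp_all only: ennreal_enn2real le_less_trans) (simp add: enn2real_leI)
  have g [measurable]: "case_prod (g l) \<in> borel_measurable (H l \<Otimes>\<^sub>M R)" for l
    unfolding g_def q_def by measurable
  define W where "W t \<omega> = (\<Prod>l<t. g l (hist l \<omega>) (\<omega> l))" for t \<omega>
  have le1: "(\<integral>\<^sup>+\<omega>. W t \<omega> \<partial>M) \<le> 1" for t
    unfolding W_def
  proof (rule nn_integral_prod_le_1[OF g])
    fix l :: nat and h assume h: "h \<in> space (H l)"
    show "(\<Sum>j=1..N. choice_prob l h j * (\<integral>\<^sup>+r. g l h (j, r) \<partial>\<Theta> j)) \<le> 1"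
    proof (cases "l < s")
      case True
      have "(\<Sum>j=1..N. choice_prob l h j * (\<integral>\<^sup>+r. g l h (j, r) \<partial>\<Theta> j)) = (\<Sum>j=1..N. choice_prob l h j)"
        using True by (intro sum.cong) (simp_all add: g_def prob_space.emeasure_space_1[OF prob_space_\<Theta>])
      with sum_choice_prob[OF h] show ?thesis by simp
    next
      case False
      have "(\<Sum>j=1..N. choice_prob l h j * (\<integral>\<^sup>+r. g l h (j, r) \<partial>\<Theta> j)) =
          (\<Sum>j\<in>{1..N}-{i}. choice_prob l h j * (\<integral>\<^sup>+r. g l h (j, r) \<partial>\<Theta> j))"
        using i False by (subst sum.remove[of _ i]) (auto simp: g_def)
      also have "\<dots> = (\<Sum>j\<in>{1..N}-{i}. choice_prob l h j * ennreal (exp (q l h)))"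
        using False
        by (intro sum.cong) (auto simp: g_def prob_space.emeasure_space_1[OF prob_space_\<Theta>])
      also have "\<dots> = (\<Sum>j\<in>{1..N}-{i}. choice_prob l h j) * ennreal (exp (q l h))"
        by (simp add: sum_distrib_right)
      \<comment> \<open>Subtraction in \<open>ennreal\<close> is truncated, so the complement is
        found by cancelling the finite summand \<open>q\<close>.\<close>
      also have "(\<Sum>j\<in>{1..N}-{i}. choice_prob l h j) = ennreal (1 - q l h)"
      proof -
        have "ennreal (q l h) + (\<Sum>j\<in>{1..N}-{i}. choice_prob l h j) = 1"
          using sum_choice_prob[OF h] i q(1)[OF h] by (simp add: sum.remove)
        then have "(\<Sum>j\<in>{1..N}-{i}. choice_prob l h j) = 1 - ennreal (q l h)"
          by (metis ennreal_add_diff_cancel_left ennreal_neq_top)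
        then show ?thesis
          by (simp add: ennreal_minus q_def flip: ennreal_1)
      qed
      also have "ennreal (1 - q l h) * ennreal (exp (q l h)) = ennreal ((1 - q l h) * exp (q l h))"
        using q(2)[OF h] by (simp add: ennreal_mult)
      \<comment> \<open>The growth \<open>exp q\<close> is offset by the survival chance, since
        \<open>1 - q \<le> exp (- q)\<close>.\<close>
      also have "\<dots> \<le> ennreal (exp (- q l h) * exp (q l h))"
        using exp_ge_add_one_self[of "- q l h"] by (intro ennreal_leI mult_right_mono) auto
      also have "\<dots> = 1"
        by (simp add: exp_add[symmetric])
      finally show ?thesis .
    qed
  qed
  have [measurable]: "W t \<in> borel_measurable M" for t
    unfolding W_def
  proof (rule borel_measurable_prod_ennreal)
    fix l
    have "(\<lambda>\<omega>. (hist l \<omega>, \<omega> l)) \<in> M \<rightarrow>\<^sub>M H l \<Otimes>\<^sub>M R"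
      by measurable
    from measurable_compose[OF this g] show "(\<lambda>\<omega>. g l (hist l \<omega>) (\<omega> l)) \<in> borel_measurable M"
      by simp
  qed
  \<comment> \<open>Fatou's lemma bounds the mean of the lower limit by \<open>1\<close>, so the
    lower limit is finite almost everywhere.\<close>
  have "(\<integral>\<^sup>+\<omega>. liminf (\<lambda>t. W t \<omega>) \<partial>M) \<le> liminf (\<lambda>t. \<integral>\<^sup>+\<omega>. W t \<omega> \<partial>M)"
    by (rule nn_integral_liminf) measurable
  also have "\<dots> \<le> limsup (\<lambda>t. \<integral>\<^sup>+\<omega>. W t \<omega> \<partial>M)"
    by (rule Liminf_le_Limsup) simp
  also have "\<dots> \<le> 1"
    by (rule Limsup_bounded) (simp add: le1)
  finally have "(\<integral>\<^sup>+\<omega>. liminf (\<lambda>t. W t \<omega>) \<partial>M) \<noteq> \<infinity>"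
    by (auto simp: top_unique)
  then have "AE \<omega> in M. liminf (\<lambda>t. W t \<omega>) \<noteq> \<infinity>"
    by (intro nn_integral_noteq_infinite) measurable
  then show ?thesis
  proof (rule AE_mp, intro AE_I2 impI notI)
    fix \<omega> assume \<omega>: "\<omega> \<in> space M" and fin: "liminf (\<lambda>t. W t \<omega>) \<noteq> \<infinity>"
      and bad: "(\<forall>l\<ge>s. fst (\<omega> l) \<noteq> i) \<and> (\<exists>\<epsilon>>0. \<forall>l\<ge>s. ennreal \<epsilon> \<le> choice_prob l (hist l \<omega>) i)"
    then obtain \<epsilon> where \<epsilon>: "\<epsilon> > 0" "\<And>l. l \<ge> s \<Longrightarrow> ennreal \<epsilon> \<le> choice_prob l (hist l \<omega>) i"
      by blast
    \<comment> \<open>On an abandoning trajectory no factor vanishes, and each one from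
      \<open>s\<close> on is at least \<open>exp \<epsilon>\<close>.\<close>
    have W: "W (s + n) \<omega> \<ge> ennreal (exp (\<epsilon> * n))" for n
    proof (induction n)
      case 0
      have "W s \<omega> = 1"
        by (simp add: W_def g_def)
      then show ?case by simp
    next
      case (Suc n)
      have "ennreal \<epsilon> \<le> ennreal (q (s + n) (hist (s + n) \<omega>))"
        using \<epsilon>(2) q(1)[OF hist_space[OF \<omega>]] by simp
      then have "\<epsilon> \<le> q (s + n) (hist (s + n) \<omega>)"
        by (subst (asm) ennreal_le_iff) (simp_all add: q_def)
      then have "ennreal (exp \<epsilon>) \<le> g (s + n) (hist (s + n) \<omega>) (\<omega> (s + n))"
        using bad by (simp add: g_def ennreal_leI)
      then have "ennreal (exp (\<epsilon> * n)) * ennreal (exp \<epsilon>) \<le> W (s + n) \<omega> * g (s + n) (hist (s + n) \<omega>) (\<omega> (s + n))"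
        by (intro mult_mono Suc.IH) auto
      also have "\<dots> = W (s + Suc n) \<omega>"
        by (simp add: W_def)
      finally show ?case
        by (simp add: ennreal_mult[symmetric] exp_add[symmetric] algebra_simps)
    qed
    obtain b where b: "liminf (\<lambda>t. W t \<omega>) = ennreal b" "0 \<le> b"
      using fin by (cases "liminf (\<lambda>t. W t \<omega>)") auto
    obtain n where n: "real n > b / \<epsilon>"
      using reals_Archimedean2 by blast
    \<comment> \<open>A linear lower bound suffices: by the choice of \<open>n\<close> it exceeds
      the supposed finite lower limit \<open>b\<close>.\<close>
    have "ennreal (1 + \<epsilon> * n) \<le> W t \<omega>" if "t \<ge> s + n" for t
    proof -
      have "1 + \<epsilon> * n \<le> 1 + \<epsilon> * real (t - s)"
        using that \<epsilon> by simp
      also have "\<dots> \<le> exp (\<epsilon> * real (t - s))"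
        by (rule exp_ge_add_one_self)
      finally have "ennreal (1 + \<epsilon> * n) \<le> ennreal (exp (\<epsilon> * real (t - s)))"
        by (rule ennreal_leI)
      also have "\<dots> \<le> W t \<omega>"
        using W[of "t - s"] that by simp
      finally show ?thesis .
    qed
    then have "ennreal (1 + \<epsilon> * n) \<le> liminf (\<lambda>t. W t \<omega>)"
      by (intro Liminf_bounded) (auto simp: eventually_sequentially)
    then have "1 + \<epsilon> * n \<le> b"
      using b by (simp add: ennreal_le_iff)
    with n \<epsilon> show False
      by (simp add: field_simps)
  qed
qed

section \<open>Pulling probabilities and rewards\<close>

lemma emeasure_action:
  assumes i: "i \<in> {1..N}"
  shows "emeasure M {\<omega>\<in>space M. fst (\<omega> t) = i} = (\<integral>\<^sup>+\<omega>. choice_prob t (hist t \<omega>) i \<partial>M)"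
proof -
  define f where "f h y = (if fst y = i then 1 else 0 :: ennreal)" for h :: "nat \<Rightarrow> nat \<times> real" and y :: "nat \<times> real"
  have "emeasure M {\<omega>\<in>space M. fst (\<omega> t) = i} =
      (\<integral>\<^sup>+\<omega>. indicator {\<omega>\<in>space M. fst (\<omega> t) = i} \<omega> \<partial>M)"
    by (rule nn_integral_indicator[symmetric]) measurable
  also have "\<dots> = (\<integral>\<^sup>+\<omega>. f (hist t \<omega>) (\<omega> t) \<partial>M)"
    by (intro nn_integral_cong) (simp add: f_def)
  also have "\<dots> = (\<integral>\<^sup>+\<omega>. (\<Sum>j=1..N. choice_prob t (hist t \<omega>) j *
      (\<integral>\<^sup>+r. f (hist t \<omega>) (j, r) \<partial>\<Theta> j)) \<partial>M)"
    by (rule nn_integral_step) (unfold f_def, measurable)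
  also have "\<dots> = (\<integral>\<^sup>+\<omega>. choice_prob t (hist t \<omega>) i \<partial>M)"
  proof (intro nn_integral_cong)
    fix \<omega>
    have "(\<Sum>j=1..N. choice_prob t (hist t \<omega>) j * (\<integral>\<^sup>+r. f (hist t \<omega>) (j, r) \<partial>\<Theta> j)) =
        (\<Sum>j=1..N. if j = i then choice_prob t (hist t \<omega>) j else 0)"
      by (intro sum.cong) (auto simp: f_def prob_space.emeasure_space_1[OF prob_space_\<Theta>])
    also have "\<dots> = choice_prob t (hist t \<omega>) i"
      using i by simp
    finally show "(\<Sum>j=1..N. choice_prob t (hist t \<omega>) j * (\<integral>\<^sup>+r. f (hist t \<omega>) (j, r) \<partial>\<Theta> j)) =
        choice_prob t (hist t \<omega>) i" .
  qed
  finally show ?thesis .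
qed

text \<open>For use with a good event \<open>G\<close> on which the policy favours arm
  \<open>i\<close>: only the part of the mean of \<open>choice_prob\<close> over \<open>G\<close> is
  kept.\<close>

lemma pull_prob_ge:
  assumes i: "i \<in> {1..N}" and G: "G \<in> sets M" and c: "0 \<le> c"
    and le: "\<And>\<omega>. \<omega> \<in> G \<Longrightarrow> ennreal c \<le> choice_prob t (hist t \<omega>) i"
  shows "c * prob G \<le> pull_prob N \<Theta> \<pi> t i"
proof -
  have "ennreal (c * prob G) = (\<integral>\<^sup>+\<omega>. ennreal c * indicator G \<omega> \<partial>M)"
    using G c by (simp add: nn_integral_cmult_indicator emeasure_eq_measure ennreal_mult)
  also have "\<dots> \<le> (\<integral>\<^sup>+\<omega>. choice_prob t (hist t \<omega>) i \<partial>M)"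
    by (intro nn_integral_mono) (auto simp: indicator_def le)
  also have "\<dots> = ennreal (pull_prob N \<Theta> \<pi> t i)"
    unfolding emeasure_action[OF i, symmetric] pull_prob_def by (rule emeasure_eq_measure)
  finally show ?thesis
    by (simp add: pull_prob_def)
qed

section \<open>Expected rewards\<close>

lemma
  shows integrable_reward: "integrable M (\<lambda>\<omega>. snd (\<omega> t))"
    and expectation_reward: "ennreal (expectation (\<lambda>\<omega>. snd (\<omega> t))) =
      (\<integral>\<^sup>+\<omega>. (\<Sum>i=1..N. choice_prob t (hist t \<omega>) i * ennreal (arm_mean \<Theta> i)) \<partial>M)"
proof -
  have [measurable]: "(\<lambda>\<omega>. snd (\<omega> t)) \<in> borel_measurable M"
    by (rule measurable_compose[OF measurable_component_M measurable_snd_R])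
  show int: "integrable M (\<lambda>\<omega>. snd (\<omega> t))"
    by (rule integrable_const_bound[of _ 1]) (auto intro!: AE_I2 simp: reward_bounds)
  define f where "f h y = ennreal (snd y)" for h :: "nat \<Rightarrow> nat \<times> real" and y :: "nat \<times> real"
  have "ennreal (expectation (\<lambda>\<omega>. snd (\<omega> t))) = (\<integral>\<^sup>+\<omega>. f (hist t \<omega>) (\<omega> t) \<partial>M)"
    unfolding f_def
    by (rule nn_integral_eq_integral[OF int, symmetric]) (auto intro!: AE_I2 simp: reward_bounds)
  also have "\<dots> = (\<integral>\<^sup>+\<omega>. (\<Sum>i=1..N. choice_prob t (hist t \<omega>) i *
      (\<integral>\<^sup>+r. f (hist t \<omega>) (i, r) \<partial>\<Theta> i)) \<partial>M)"
    by (rule nn_integral_step) (unfold f_def, measurable)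
  also have "\<dots> = (\<integral>\<^sup>+\<omega>. (\<Sum>i=1..N. choice_prob t (hist t \<omega>) i * ennreal (arm_mean \<Theta> i)) \<partial>M)"
    by (intro nn_integral_cong sum.cong refl) (simp add: f_def arm_mean(1))
  finally show "ennreal (expectation (\<lambda>\<omega>. snd (\<omega> t))) = \<dots>" .
qed

lemma expected_reward_eq: "expected_reward N \<Theta> \<pi> T = (\<Sum>t<T. expectation (\<lambda>\<omega>. snd (\<omega> t)))"
  unfolding expected_reward_def by (rule Bochner_Integration.integral_sum) (rule integrable_reward)

lemma arms_nonempty: "{1..N} \<noteq> {}"
  using inst by (auto simp: bandit_instance_def is_arg_max_def)

lemma arm_mean_le_optimal: "i \<in> {1..N} \<Longrightarrow> arm_mean \<Theta> i \<le> optimal_mean N \<Theta>"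
  unfolding optimal_mean_def by (intro Max_ge) auto

lemma optimal_mean_nonneg: "0 \<le> optimal_mean N \<Theta>"
proof -
  obtain i where "i \<in> {1..N}" using arms_nonempty by blast
  then show ?thesis using arm_mean(2) arm_mean_le_optimal by (meson order.trans)
qed

text \<open>Given the history, the mean reward is a convex combination of the arm means.\<close>

lemma expectation_reward_le: "expectation (\<lambda>\<omega>. snd (\<omega> t)) \<le> optimal_mean N \<Theta>"
proof -
  have "(\<integral>\<^sup>+\<omega>. (\<Sum>i=1..N. choice_prob t (hist t \<omega>) i * ennreal (arm_mean \<Theta> i)) \<partial>M) \<le>
      (\<integral>\<^sup>+\<omega>. ennreal (optimal_mean N \<Theta>) \<partial>M)"
  proof (intro nn_integral_mono)
    fix \<omega> assume "\<omega> \<in> space M"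
    then have h: "hist t \<omega> \<in> space (H t)" by (rule hist_space)
    have "(\<Sum>i=1..N. choice_prob t (hist t \<omega>) i * ennreal (arm_mean \<Theta> i)) \<le>
        (\<Sum>i=1..N. choice_prob t (hist t \<omega>) i * ennreal (optimal_mean N \<Theta>))"
      by (intro sum_mono mult_left_mono ennreal_leI arm_mean_le_optimal) auto
    also have "\<dots> = ennreal (optimal_mean N \<Theta>)"
      unfolding sum_distrib_right[symmetric] sum_choice_prob[OF h] by simp
    finally show "(\<Sum>i=1..N. choice_prob t (hist t \<omega>) i * ennreal (arm_mean \<Theta> i)) \<le>
        ennreal (optimal_mean N \<Theta>)" .
  qed
  also have "\<dots> = ennreal (optimal_mean N \<Theta>)"
    by (simp add: emeasure_space_1)
  finally show ?thesis
    unfolding expectation_reward[symmetric] by (simp add: ennreal_le_iff optimal_mean_nonneg)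
qed

lemma expectation_reward_ge:
  assumes i: "i \<in> {1..N}"
  shows "arm_mean \<Theta> i * pull_prob N \<Theta> \<pi> t i \<le> expectation (\<lambda>\<omega>. snd (\<omega> t))"
proof -
  have m: "(\<lambda>\<omega>. choice_prob t (hist t \<omega>) i) \<in> borel_measurable M"
    using measurable_compose[OF measurable_hist measurable_choice_prob[OF i]] .
  have "ennreal (arm_mean \<Theta> i * pull_prob N \<Theta> \<pi> t i) =
      ennreal (arm_mean \<Theta> i) * (\<integral>\<^sup>+\<omega>. choice_prob t (hist t \<omega>) i \<partial>M)"
    unfolding emeasure_action[OF i, symmetric] pull_prob_def emeasure_eq_measure
    by (rule ennreal_mult) (simp_all add: arm_mean(2)[OF i])
  also have "\<dots> = (\<integral>\<^sup>+\<omega>. choice_prob t (hist t \<omega>) i * ennreal (arm_mean \<Theta> i) \<partial>M)"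
    by (subst nn_integral_cmult[OF m, symmetric]) (simp add: mult.commute)
  also have "\<dots> \<le> (\<integral>\<^sup>+\<omega>. (\<Sum>i=1..N. choice_prob t (hist t \<omega>) i * ennreal (arm_mean \<Theta> i)) \<partial>M)"
    by (intro nn_integral_mono member_le_sum[OF i]) auto
  finally show ?thesis
    unfolding expectation_reward[symmetric]
    by (subst (asm) ennreal_le_iff) (auto intro!: Bochner_Integration.integral_nonneg simp: reward_bounds)
qed

lemma long_run_average_le: "long_run_average N \<Theta> \<pi> \<le> ereal (optimal_mean N \<Theta>)"
  unfolding long_run_average_def
proof (rule Limsup_bounded, rule always_eventually, rule allI)
  fix T
  have "expected_reward N \<Theta> \<pi> T \<le> (\<Sum>t<T. optimal_mean N \<Theta>)"
    unfolding expected_reward_eq by (rule sum_mono) (rule expectation_reward_le)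
  then show "ereal (expected_reward N \<Theta> \<pi> T / real T) \<le> ereal (optimal_mean N \<Theta>)"
    \<comment> \<open>At \<open>T = 0\<close> the quotient is \<open>0\<close> by convention, and
      nonnegativity of the optimal mean settles that case.\<close>
    by (cases "T = 0") (simp_all add: divide_simps mult.commute optimal_mean_nonneg)
qed

end

text \<open>Turns a vanishing loss per round into sublinear regret.\<close>

lemma cesaro_null:
  fixes a :: "nat \<Rightarrow> real"
  assumes "a \<longlonglongrightarrow> 0"
  shows "(\<lambda>n. (\<Sum>t<n. a t) / real n) \<longlonglongrightarrow> 0"
proof (rule LIMSEQ_I)
  fix \<epsilon> :: real assume "0 < \<epsilon>"
  then obtain m where m: "\<And>t. t \<ge> m \<Longrightarrow> \<bar>a t\<bar> < \<epsilon> / 2"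
    using LIMSEQ_D[OF assms, of "\<epsilon> / 2"] by auto
  define C where "C = (\<Sum>t<m. \<bar>a t\<bar>)"
  obtain n0 where n0: "real n0 > 2 * C / \<epsilon>"
    using reals_Archimedean2 by blast
  show "\<exists>no. \<forall>n\<ge>no. norm ((\<Sum>t<n. a t) / real n - 0) < \<epsilon>"
  proof (intro exI allI impI)
    \<comment> \<open>Beyond \<open>n0\<close> the head \<open>C\<close> is less than half of
      \<open>real n * \<epsilon>\<close>; the successor also keeps the divisor positive.\<close>
    fix n assume n: "max m (Suc n0) \<le> n"
    have "\<bar>\<Sum>t<n. a t\<bar> \<le> (\<Sum>t<n. \<bar>a t\<bar>)"
      by (rule sum_abs)
    also have "\<dots> = C + (\<Sum>t\<in>{m..<n}. \<bar>a t\<bar>)"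
      using n sum.atLeastLessThan_concat[of 0 m n "\<lambda>t. \<bar>a t\<bar>"] by (simp add: C_def lessThan_atLeast0)
    also have "\<dots> \<le> C + (\<Sum>t\<in>{m..<n}. \<epsilon> / 2)"
      by (intro add_left_mono sum_mono) (use m in \<open>auto intro: less_imp_le\<close>)
    also have "\<dots> \<le> C + real n * (\<epsilon> / 2)"
      using \<open>0 < \<epsilon>\<close> by (simp add: mult_right_mono)
    also have "\<dots> < real n * \<epsilon>"
    proof -
      have "2 * C / \<epsilon> < real n" using n0 n by linarith
      then show ?thesis using \<open>0 < \<epsilon>\<close> by (simp add: field_simps)
    qed
    finally show "norm ((\<Sum>t<n. a t) / real n - 0) < \<epsilon>"
      using n by (simp add: divide_simps mult.commute)
  qed
qed

section \<open>Transport to other arms by anonymity\<close>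

text \<open>A permutation of the arms fixes every index outside \<open>{1..N}\<close>, so the
  permuted vectors remain undefined there.\<close>

lemma permute_state:
  assumes "\<sigma> permutes {1..N}" and "(\<kappa>, u) \<in> space (state_space N)"
  shows "(\<kappa> \<circ> \<sigma>, u \<circ> \<sigma>) \<in> space (state_space N)"
  using assms permutes_in_image[OF assms(1)] permutes_not_in[OF assms(1)]
  by (auto simp: state_space_def space_pair_measure space_PiM PiE_iff extensional_def space_restrict_space
      simp del: atLeastAtMost_iff)

text \<open>Swapping the labels \<open>1\<close> and \<open>j\<close> transfers properties stated
  for arm \<open>1\<close> to arm \<open>j\<close>.\<close>

lemma anonymous_transpose:
  assumes "anonymous N Q" and j: "j \<in> {1..N}" and S: "(\<kappa>, u) \<in> space (state_space N)"
  shows "Q 1 (\<kappa> \<circ> Transposition.transpose 1 j, u \<circ> Transposition.transpose 1 j) = Q j (\<kappa>, u)"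
proof -
  have "Transposition.transpose 1 j permutes {1..N}"
    using j by (intro permutes_swap_id) auto
  moreover have "1 \<in> {1..N}"
    using j by auto
  ultimately show ?thesis
    using assms unfolding anonymous_def by fastforce
qed

text \<open>The bound depends only on the arm's own state \<open>(k, x)\<close> and is uniform over
  the other arms, which continue to evolve while arm \<open>j\<close> is frozen.\<close>

lemma recurrent_arm:
  assumes "anonymous N Q" "recurrent N Q" and j: "j \<in> {1..N}" and "x \<in> {0..1}"
  obtains \<epsilon> where "\<epsilon> > 0"
    "\<And>\<kappa> u. (\<kappa>, u) \<in> space (state_space N) \<Longrightarrow> \<kappa> j = k \<Longrightarrow> u j = x \<Longrightarrow> \<epsilon> \<le> Q j (\<kappa>, u)"
proof -
  let ?\<sigma> = "Transposition.transpose 1 j"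
  have \<sigma>: "?\<sigma> permutes {1..N}"
    using j by (intro permutes_swap_id) auto
  obtain \<epsilon> where \<epsilon>: "\<epsilon> > 0" "\<And>\<kappa> u. (\<kappa>, u) \<in> space (state_space N) \<Longrightarrow> \<kappa> 1 = k \<Longrightarrow> u 1 = x \<Longrightarrow> \<epsilon> \<le> Q 1 (\<kappa>, u)"
    using assms(2)[unfolded recurrent_def, rule_format, OF assms(4), of k] by auto
  show thesis
  proof (rule that[OF \<epsilon>(1)])
    fix \<kappa> u assume S: "(\<kappa>, u) \<in> space (state_space N)" "\<kappa> j = k" "u j = x"
    then show "\<epsilon> \<le> Q j (\<kappa>, u)"
      using \<epsilon>(2)[OF permute_state[OF \<sigma> S(1)]] anonymous_transpose[OF assms(1) j S(1)] by simp
  qed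
qed

text \<open>Convergence along sequences becomes a threshold uniform over states: if no
  \<open>K\<close> worked, the counterexamples for \<open>K = 0, 1, 2, ...\<close> would form a
  sequence that satisfies the hypotheses of leading-arm convergence and violates its
  conclusion.\<close>

lemma leading_arm_uniform:
  assumes lead: "leading_arm_convergent N Q" and "0 < \<eta>" "0 < \<delta>"
  obtains K where "\<And>\<kappa> u. (\<kappa>, u) \<in> space (state_space N) \<Longrightarrow> (\<And>i. i \<in> {1..N} \<Longrightarrow> K \<le> \<kappa> i) \<Longrightarrow>
    (\<And>i. i \<in> {2..N} \<Longrightarrow> \<delta> \<le> u 1 - u i) \<Longrightarrow> 1 - \<eta> \<le> Q 1 (\<kappa>, u)"
proof (rule ccontr)
  assume "\<not> thesis"
  then have "\<forall>K. \<exists>\<kappa> u. (\<kappa>, u) \<in> space (state_space N) \<and> (\<forall>i\<in>{1..N}. K \<le> \<kappa> i) \<and>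
    (\<forall>i\<in>{2..N}. \<delta> \<le> u 1 - u i) \<and> \<not> 1 - \<eta> \<le> Q 1 (\<kappa>, u)"
    using that by metis
  then obtain \<kappa> u where S: "\<And>K. (\<kappa> K, u K) \<in> space (state_space N)"
    and \<kappa>: "\<And>K i. i \<in> {1..N} \<Longrightarrow> K \<le> \<kappa> K i"
    and u: "\<And>K i. i \<in> {2..N} \<Longrightarrow> \<delta> \<le> u K 1 - u K i"
    and Q: "\<And>K. Q 1 (\<kappa> K, u K) < 1 - \<eta>"
    unfolding not_le by metis
  have "asymp_omega (\<lambda>T. real (\<kappa> T i)) (\<lambda>_. 1)" if "i \<in> {1..N}" for i
  proof -
    have "filterlim (\<lambda>T. real (\<kappa> T i)) at_top sequentially"
      by (rule filterlim_at_top_mono[OF filterlim_real_sequentially]) (use \<kappa>[OF that] in simp)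
    then have "(\<lambda>T. ereal (real (\<kappa> T i))) \<longlonglongrightarrow> \<infinity>"
      by (simp add: tendsto_PInfty_eq_at_top)
    then show ?thesis
      unfolding asymp_omega_def by (simp add: lim_imp_Liminf)
  qed
  moreover have "asymp_Omega (\<lambda>T. u T 1 - u T i) (\<lambda>_. 1)" if "i \<in> {2..N}" for i
  proof -
    have "0 < ereal \<delta>"
      using \<open>0 < \<delta>\<close> by simp
    also have "\<dots> \<le> liminf (\<lambda>T. ereal ((u T 1 - u T i) / 1))"
      by (rule Liminf_bounded) (use u[OF that] in simp)
    finally show ?thesis
      unfolding asymp_Omega_def .
  qed
  ultimately have "asymp_o (\<lambda>T. 1 - Q 1 (\<kappa> T, u T)) (\<lambda>_. 1)"
    using lead S unfolding leading_arm_convergent_def by blast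
  moreover have "ereal \<eta> \<le> limsup (\<lambda>T. ereal ((1 - Q 1 (\<kappa> T, u T)) / 1))"
  proof (rule order_trans[OF _ Liminf_le_Limsup])
    show "ereal \<eta> \<le> liminf (\<lambda>T. ereal ((1 - Q 1 (\<kappa> T, u T)) / 1))"
    proof (rule Liminf_bounded, rule always_eventually, rule allI)
      show "ereal \<eta> \<le> ereal ((1 - Q 1 (\<kappa> T, u T)) / 1)" for T
        using Q[of T] by simp
    qed
  qed simp
  ultimately show False
    using \<open>0 < \<eta>\<close> by (simp add: asymp_o_def)
qed

lemma leading_arm_uniform_arm:
  assumes anon: "anonymous N Q" and lead: "leading_arm_convergent N Q" and j: "j \<in> {1..N}"
    and "0 < \<eta>" "0 < \<delta>"
  obtains K where "\<And>\<kappa> u. (\<kappa>, u) \<in> space (state_space N) \<Longrightarrow> (\<And>i. i \<in> {1..N} \<Longrightarrow> K \<le> \<kappa> i) \<Longrightarrow>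
    (\<And>i. i \<in> {1..N} - {j} \<Longrightarrow> \<delta> \<le> u j - u i) \<Longrightarrow> 1 - \<eta> \<le> Q j (\<kappa>, u)"
proof -
  let ?\<sigma> = "Transposition.transpose 1 j"
  have \<sigma>: "?\<sigma> permutes {1..N}"
    using j by (intro permutes_swap_id) auto
  obtain K where K: "\<And>\<kappa> u. (\<kappa>, u) \<in> space (state_space N) \<Longrightarrow> (\<And>i. i \<in> {1..N} \<Longrightarrow> K \<le> \<kappa> i) \<Longrightarrow>
    (\<And>i. i \<in> {2..N} \<Longrightarrow> \<delta> \<le> u 1 - u i) \<Longrightarrow> 1 - \<eta> \<le> Q 1 (\<kappa>, u)"
    using leading_arm_uniform[OF lead assms(4,5)] by metis
  show thesis
  proof (rule that[of K])
    fix \<kappa> u assume S: "(\<kappa>, u) \<in> space (state_space N)" and \<kappa>: "\<And>i. i \<in> {1..N} \<Longrightarrow> K \<le> \<kappa> i"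
      and u: "\<And>i. i \<in> {1..N} - {j} \<Longrightarrow> \<delta> \<le> u j - u i"
    have "1 - \<eta> \<le> Q 1 (\<kappa> \<circ> ?\<sigma>, u \<circ> ?\<sigma>)"
    proof (rule K[OF permute_state[OF \<sigma> S]])
      show "K \<le> (\<kappa> \<circ> ?\<sigma>) i" if "i \<in> {1..N}" for i
        using \<kappa>[of "?\<sigma> i"] permutes_in_image[OF \<sigma>] that by simp
      \<comment> \<open>The swap sends \<open>1\<close> to \<open>j\<close> and
        \<open>{2..N}\<close> into \<open>{1..N} - {j}\<close>.\<close>
      show "\<delta> \<le> (u \<circ> ?\<sigma>) 1 - (u \<circ> ?\<sigma>) i" if "i \<in> {2..N}" for i
        using u[of "?\<sigma> i"] that j by (auto simp: Transposition.transpose_def split: if_splits)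
    qed
    then show "1 - \<eta> \<le> Q j (\<kappa>, u)"
      using anonymous_transpose[OF anon j S] by simp
  qed
qed

section \<open>Markovian policies\<close>

locale markov_bandit =
  fixes N :: nat and Q :: "nat \<Rightarrow> (nat \<Rightarrow> nat) \<times> (nat \<Rightarrow> real) \<Rightarrow> real"
    and \<Theta> :: "nat \<Rightarrow> real measure"
  assumes prob_fun: "probability_function N Q" and anon: "anonymous N Q"
    and rec: "recurrent N Q" and lead: "leading_arm_convergent N Q"
    and inst: "bandit_instance N \<Theta>"
begin

sublocale bandit N \<Theta> "markov_policy N Q"
  by standard (rule inst, rule admissible_markov_policy[OF prob_fun])

lemma choice_prob_markov:
  assumes "i \<in> {1..N}"
  shows "choice_prob t (hist t \<omega>) i = ennreal (Q i (bandit_state N t \<omega>))"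
  using assms by (simp add: choice_prob_def markov_policy_def emeasure_point_measure_finite bandit_state_hist)

lemma bandit_state_in: "\<omega> \<in> space M \<Longrightarrow> bandit_state N t \<omega> \<in> space (state_space N)"
  by (rule measurable_space[OF measurable_bandit_state_M])

text \<open>After a last pull the state of arm \<open>i\<close> no longer changes, so
  \<open>recurrent_arm\<close> supplies one lower bound for all later pulling probabilities, as
  excluded by \<open>AE_not_abandoned\<close>. The time \<open>s\<close> ranges over a countable
  set, so one null set serves all of them.\<close>

lemma AE_infinitely_often:
  assumes i: "i \<in> {1..N}"
  shows "AE \<omega> in M. infinite {l. fst (\<omega> l) = i}"
proof -
  have "AE \<omega> in M. \<forall>s. \<not> ((\<forall>l\<ge>s. fst (\<omega> l) \<noteq> i) \<and>
      (\<exists>\<epsilon>>0. \<forall>l\<ge>s. ennreal \<epsilon> \<le> choice_prob l (hist l \<omega>) i))"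
    unfolding AE_all_countable using AE_not_abandoned[OF i] by blast
  then show ?thesis
  proof (rule AE_mp, intro AE_I2 impI notI)
    fix \<omega> assume \<omega>: "\<omega> \<in> space M"
      and not: "\<forall>s. \<not> ((\<forall>l\<ge>s. fst (\<omega> l) \<noteq> i) \<and>
        (\<exists>\<epsilon>>0. \<forall>l\<ge>s. ennreal \<epsilon> \<le> choice_prob l (hist l \<omega>) i))"
      and "finite {l. fst (\<omega> l) = i}"
    then obtain s where s: "\<And>l. l \<ge> s \<Longrightarrow> fst (\<omega> l) \<noteq> i"
      unfolding finite_nat_set_iff_bounded by (auto simp: not_less[symmetric])
    have L: "{l. l < t \<and> fst (\<omega> l) = i} = {l. l < s \<and> fst (\<omega> l) = i}" if "t \<ge> s" for t
      using s that by (auto simp: not_le[symmetric])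
    have frozen: "fst (bandit_state N t \<omega>) i = pull_count s \<omega> i"
      "snd (bandit_state N t \<omega>) i = empirical_mean s \<omega> i" if "t \<ge> s" for t
      using i L[OF that] by (simp_all add: bandit_state_def pull_count_def empirical_mean_def)
    have "empirical_mean s \<omega> i \<in> {0..1}"
      using bandit_state_in[OF \<omega>, of s] i
      by (auto simp: bandit_state_def state_space_def space_pair_measure space_PiM PiE_iff space_restrict_space
          simp del: atLeastAtMost_iff)
    then obtain \<epsilon> where \<epsilon>: "\<epsilon> > 0" "\<And>\<kappa> u. (\<kappa>, u) \<in> space (state_space N) \<Longrightarrow> \<kappa> i = pull_count s \<omega> i \<Longrightarrow>
        u i = empirical_mean s \<omega> i \<Longrightarrow> \<epsilon> \<le> Q i (\<kappa>, u)"
      using recurrent_arm[OF anon rec i] by metis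
    have "\<epsilon> \<le> Q i (bandit_state N t \<omega>)" if "t \<ge> s" for t
      using \<epsilon>(2)[of "fst (bandit_state N t \<omega>)" "snd (bandit_state N t \<omega>)"] frozen[OF that]
        bandit_state_in[OF \<omega>] by simp
    then have "\<forall>l\<ge>s. ennreal \<epsilon> \<le> choice_prob l (hist l \<omega>) i"
      by (auto simp: choice_prob_markov[OF i] intro: ennreal_leI)
    with not s \<epsilon>(1) show False
      by blast
  qed
qed

text \<open>On almost every trajectory the count eventually reaches \<open>K\<close>, so the
  indicators converge to \<open>1\<close>, and dominated convergence gives their
  expectations.\<close>

lemma prob_pull_count_ge:
  assumes i: "i \<in> {1..N}"
  shows "(\<lambda>t. prob {\<omega>\<in>space M. K \<le> pull_count t \<omega> i}) \<longlonglongrightarrow> 1"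
proof -
  note [measurable] = measurable_pull_count[OF i]
  let ?A = "\<lambda>t. {\<omega>\<in>space M. K \<le> pull_count t \<omega> i}"
  have "(\<lambda>t. expectation (indicat_real (?A t))) \<longlonglongrightarrow> expectation (\<lambda>_. 1)"
  proof (rule integral_dominated_convergence[where w = "\<lambda>_. 1"])
    show "AE \<omega> in M. (\<lambda>t. indicat_real (?A t) \<omega>) \<longlonglongrightarrow> 1"
      using AE_infinitely_often[OF i]
    proof (rule AE_mp, intro AE_I2 impI)
      fix \<omega> assume \<omega>: "\<omega> \<in> space M" "infinite {l. fst (\<omega> l) = i}"
      then obtain B where B: "finite B" "card B = K" "B \<subseteq> {l. fst (\<omega> l) = i}"
        using infinite_arbitrarily_large by blast
      then obtain s where s: "\<And>l. l \<in> B \<Longrightarrow> l < s"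
        unfolding finite_nat_set_iff_bounded by auto
      have "K \<le> pull_count t \<omega> i" if "t \<ge> s" for t
        unfolding pull_count_def B(2)[symmetric]
        by (rule card_mono) (use B(3) s that in \<open>auto dest: order.strict_trans2\<close>)
      then show "(\<lambda>t. indicat_real (?A t) \<omega>) \<longlonglongrightarrow> 1"
        using \<omega> by (intro tendsto_eventually eventually_sequentiallyI[of s]) simp
    qed
  qed (auto simp: indicator_def)
  then show ?thesis
    by (simp add: prob_space)
qed

section \<open>The optimal arm and its gap\<close>

lemma optimal_arm: "optimal_arm N \<Theta> \<in> {1..N}" "arm_mean \<Theta> (optimal_arm N \<Theta>) = optimal_mean N \<Theta>"
  "i \<in> {1..N} - {optimal_arm N \<Theta>} \<Longrightarrow> arm_mean \<Theta> i < arm_mean \<Theta> (optimal_arm N \<Theta>)"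
proof -
  let ?j = "optimal_arm N \<Theta>"
  have ex1: "\<exists>!i. is_arg_max (arm_mean \<Theta>) (\<lambda>i. i \<in> {1..N}) i"
    using inst by (simp add: bandit_instance_def)
  then have j: "is_arg_max (arm_mean \<Theta>) (\<lambda>i. i \<in> {1..N}) ?j"
    unfolding optimal_arm_def arg_max_def by (metis someI_ex)
  then show "?j \<in> {1..N}" by (simp add: is_arg_max_linorder)
  with j show "arm_mean \<Theta> ?j = optimal_mean N \<Theta>"
    unfolding optimal_mean_def by (intro Max_eqI[symmetric]) (auto simp: is_arg_max_linorder)
  show "arm_mean \<Theta> i < arm_mean \<Theta> ?j" if i: "i \<in> {1..N} - {?j}"
  proof (rule ccontr)
    assume "\<not> arm_mean \<Theta> i < arm_mean \<Theta> ?j"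
    then have "is_arg_max (arm_mean \<Theta>) (\<lambda>i. i \<in> {1..N}) i"
      using j i unfolding is_arg_max_linorder by force
    with ex1 j i show False by blast
  qed
qed

lemma obtain_gap:
  obtains \<Delta> where "0 < \<Delta>"
    "\<And>i. i \<in> {1..N} - {optimal_arm N \<Theta>} \<Longrightarrow> arm_mean \<Theta> i + \<Delta> \<le> optimal_mean N \<Theta>"
proof
  \<comment> \<open>The inserted \<open>1\<close> keeps the set nonempty, so that its
    \<open>Min\<close> is meaningful.\<close>
  let ?S = "insert 1 ((\<lambda>i. optimal_mean N \<Theta> - arm_mean \<Theta> i) ` ({1..N} - {optimal_arm N \<Theta>}))"
  show "0 < Min ?S"
    using optimal_arm(2,3) by (subst Min_gr_iff) auto
  show "arm_mean \<Theta> i + Min ?S \<le> optimal_mean N \<Theta>" if "i \<in> {1..N} - {optimal_arm N \<Theta>}" for i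
  proof -
    have "Min ?S \<le> optimal_mean N \<Theta> - arm_mean \<Theta> i"
      using that by (intro Min_le) auto
    then show ?thesis by simp
  qed
qed

text \<open>The order of choices matters: the tolerance \<open>\<eta>\<close>, the accuracy
  \<open>\<delta>\<close> from the gap, the sample threshold \<open>K\<close>, and only then
  \<open>t\<close>. Given \<open>K\<close>, deviations are controlled at every time, and the chance
  that some count is below \<open>K\<close> vanishes as \<open>t\<close> grows.\<close>

lemma pull_prob_tendsto: "(\<lambda>t. pull_prob N \<Theta> (markov_policy N Q) t (optimal_arm N \<Theta>)) \<longlonglongrightarrow> 1"
proof (rule order_tendstoI)
  let ?j = "optimal_arm N \<Theta>"
  show "eventually (\<lambda>t. pull_prob N \<Theta> (markov_policy N Q) t ?j < a) sequentially" if "1 < a" for a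
    using that by (intro always_eventually) (auto simp: pull_prob_def intro: le_less_trans[OF prob_le_1])
  fix a :: real assume "a < 1"
  \<comment> \<open>The final bound loses less than \<open>3 * \<eta>\<close>; the cap
    \<open>1 / 2\<close> keeps \<open>1 - \<eta>\<close> positive.\<close>
  define \<eta> where "\<eta> = min (1 / 2) ((1 - a) / 4)"
  have \<eta>: "0 < \<eta>" "\<eta> < 1" "a < 1 - 3 * \<eta>"
    using \<open>a < 1\<close> min.cobounded2[of "1 / 2" "(1 - a) / 4"] unfolding \<eta>_def by (simp, simp, argo)
  obtain \<Delta> where \<Delta>: "0 < \<Delta>" "\<And>i. i \<in> {1..N} - {?j} \<Longrightarrow> arm_mean \<Theta> i + \<Delta> \<le> optimal_mean N \<Theta>"
    using obtain_gap by blast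
  \<comment> \<open>Each of two empirical means may err by \<open>2 * \<delta>\<close>, which leaves
    \<open>4 * \<delta>\<close> of the gap \<open>8 * \<delta>\<close>.\<close>
  define \<delta> where "\<delta> = \<Delta> / 8"
  have \<delta>: "0 < \<delta>" using \<Delta> by (simp add: \<delta>_def)
  obtain K0 where K0: "\<And>\<kappa> u. (\<kappa>, u) \<in> space (state_space N) \<Longrightarrow> (\<And>i. i \<in> {1..N} \<Longrightarrow> K0 \<le> \<kappa> i) \<Longrightarrow>
      (\<And>i. i \<in> {1..N} - {?j} \<Longrightarrow> 4 * \<delta> \<le> u ?j - u i) \<Longrightarrow> 1 - \<eta> \<le> Q ?j (\<kappa>, u)"
    using leading_arm_uniform_arm[OF anon lead optimal_arm(1), of \<eta> "4 * \<delta>"] \<eta> \<delta> by auto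
  \<comment> \<open>\<open>K\<close> has to meet three demands: the deviations of all arms together
    are below \<open>\<eta>\<close>, leading-arm convergence applies (\<open>K0\<close>), and the
    bias is absorbed (\<open>K1\<close>).\<close>
  have "(\<lambda>K. real N * (2 * exp (- 2 * \<delta>\<^sup>2) ^ K)) \<longlonglongrightarrow> 0"
    using \<delta> by (intro tendsto_mult_right_zero LIMSEQ_power_zero) auto
  then have "eventually (\<lambda>K. real N * (2 * exp (- 2 * \<delta>\<^sup>2) ^ K) < \<eta>) sequentially"
    using \<eta>(1) by (rule order_tendstoD)
  moreover obtain K1 :: nat where "1 / \<delta> \<le> real K1"
    using real_arch_simple by blast
  ultimately obtain K where K: "real N * (2 * exp (- 2 * \<delta>\<^sup>2) ^ K) < \<eta>" "K0 \<le> K" "K1 \<le> K"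
    unfolding eventually_sequentially by (metis linorder_le_cases max.coboundedI1 max.coboundedI2 max_def)
  have \<delta>K: "1 \<le> \<delta> * real K"
  proof -
    have "1 / \<delta> \<le> real K" using K(3) \<open>1 / \<delta> \<le> real K1\<close> by linarith
    then show ?thesis using \<delta> by (simp add: field_simps)
  qed
  have expK: "exp (- 2 * \<delta>\<^sup>2) ^ K = exp (- 2 * \<delta>\<^sup>2 * real K)"
    by (simp add: exp_of_nat_mult[symmetric] mult_ac)
  let ?A = "\<lambda>t i. {\<omega>\<in>space M. K \<le> pull_count t \<omega> i}"
  let ?B = "\<lambda>t i. {\<omega>\<in>space M. K \<le> pull_count t \<omega> i \<and> 2 * \<delta> \<le> \<bar>empirical_mean t \<omega> i - arm_mean \<Theta> i\<bar>}"
  \<comment> \<open>The good event: every arm has at least \<open>K\<close> samples and an empirical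
    mean within \<open>2 * \<delta>\<close> of its true mean.\<close>
  define G where "G t = space M - (\<Union>i\<in>{1..N}. (space M - ?A t i) \<union> ?B t i)" for t
  have A [measurable]: "?A t i \<in> events" and B [measurable]: "?B t i \<in> events" if i: "i \<in> {1..N}" for t i
  proof -
    note [measurable] = measurable_pull_count[OF i] measurable_empirical_mean[OF i]
    show "?A t i \<in> events" "?B t i \<in> events" by measurable
  qed
  have G: "G t \<in> events" for t
    unfolding G_def by (intro sets.Diff sets.finite_UN sets.Un sets.top A B) auto
  have prob_G: "1 - ((\<Sum>i=1..N. 1 - prob (?A t i)) + \<eta>) \<le> prob (G t)" for t
  proof -
    have "prob (\<Union>i\<in>{1..N}. (space M - ?A t i) \<union> ?B t i) \<le> (\<Sum>i=1..N. prob ((space M - ?A t i) \<union> ?B t i))"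
      by (rule finite_measure_subadditive_finite) (use A B in auto)
    also have "\<dots> \<le> (\<Sum>i=1..N. (1 - prob (?A t i)) + 2 * exp (- 2 * \<delta>\<^sup>2) ^ K)"
    proof (intro sum_mono)
      fix i assume i: "i \<in> {1..N}"
      have "prob ((space M - ?A t i) \<union> ?B t i) \<le> prob (space M - ?A t i) + prob (?B t i)"
        by (rule measure_Un_le) (use A[OF i] B[OF i] in auto)
      also have "\<dots> \<le> (1 - prob (?A t i)) + 2 * exp (- 2 * \<delta>\<^sup>2) ^ K"
        unfolding expK by (intro add_mono deviation[OF i \<delta> \<delta>K]) (simp add: prob_compl[OF A[OF i]])
      finally show "prob ((space M - ?A t i) \<union> ?B t i) \<le> (1 - prob (?A t i)) + 2 * exp (- 2 * \<delta>\<^sup>2) ^ K" .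
    qed
    also have "\<dots> = (\<Sum>i=1..N. 1 - prob (?A t i)) + real N * (2 * exp (- 2 * \<delta>\<^sup>2) ^ K)"
      by (simp add: sum.distrib)
    also have "\<dots> \<le> (\<Sum>i=1..N. 1 - prob (?A t i)) + \<eta>"
      using K(1) by simp
    finally have "prob (\<Union>i\<in>{1..N}. (space M - ?A t i) \<union> ?B t i) \<le> (\<Sum>i=1..N. 1 - prob (?A t i)) + \<eta>" .
    moreover have "prob (G t) = 1 - prob (\<Union>i\<in>{1..N}. (space M - ?A t i) \<union> ?B t i)"
      unfolding G_def by (rule prob_compl) (intro sets.finite_UN sets.Un sets.Diff sets.top A B, auto)
    ultimately show ?thesis by simp
  qed
  \<comment> \<open>With \<open>K\<close> now fixed, recurrence makes insufficient counts unlikely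
    for large \<open>t\<close>.\<close>
  have "(\<lambda>t. \<Sum>i=1..N. 1 - prob (?A t i)) \<longlonglongrightarrow> (\<Sum>i=1..N. 1 - 1)"
    by (intro tendsto_intros prob_pull_count_ge)
  then have "eventually (\<lambda>t. (\<Sum>i=1..N. 1 - prob (?A t i)) < \<eta>) sequentially"
    using \<eta>(1) by (intro order_tendstoD) auto
  then show "eventually (\<lambda>t. a < pull_prob N \<Theta> (markov_policy N Q) t ?j) sequentially"
  proof (rule eventually_mono)
    fix t assume t: "(\<Sum>i=1..N. 1 - prob (?A t i)) < \<eta>"
    have "(1 - \<eta>) * prob (G t) \<le> pull_prob N \<Theta> (markov_policy N Q) t ?j"
    proof (rule pull_prob_ge[OF optimal_arm(1) G])
      fix \<omega> assume \<omega>: "\<omega> \<in> G t"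
      then have sp: "\<omega> \<in> space M" by (simp add: G_def)
      have good: "K \<le> pull_count t \<omega> i" "\<bar>empirical_mean t \<omega> i - arm_mean \<Theta> i\<bar> < 2 * \<delta>" if "i \<in> {1..N}" for i
        using \<omega> that by (auto simp: G_def not_le[symmetric])
      have "1 - \<eta> \<le> Q ?j (fst (bandit_state N t \<omega>), snd (bandit_state N t \<omega>))"
      proof (rule K0)
        show "(fst (bandit_state N t \<omega>), snd (bandit_state N t \<omega>)) \<in> space (state_space N)"
          using bandit_state_in[OF sp] by simp
        show "K0 \<le> fst (bandit_state N t \<omega>) i" if "i \<in> {1..N}" for i
          using good(1)[OF that] that K(2) by (simp add: bandit_state_def)
        show "4 * \<delta> \<le> snd (bandit_state N t \<omega>) ?j - snd (bandit_state N t \<omega>) i" if i: "i \<in> {1..N} - {?j}" for i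
        proof -
          have "snd (bandit_state N t \<omega>) ?j - snd (bandit_state N t \<omega>) i =
              empirical_mean t \<omega> ?j - empirical_mean t \<omega> i"
            using i optimal_arm(1) by (simp add: bandit_state_def)
          then show ?thesis
            using good(2)[OF optimal_arm(1)] good(2)[of i] i \<Delta>(2)[OF i] optimal_arm(2)
            unfolding \<delta>_def abs_less_iff by (simp only: Diff_iff) argo
        qed
      qed
      then show "ennreal (1 - \<eta>) \<le> choice_prob t (hist t \<omega>) ?j"
        unfolding choice_prob_markov[OF optimal_arm(1)] by (intro ennreal_leI) simp
    qed (use \<eta> in simp)
    moreover have "1 - 2 * \<eta> \<le> prob (G t)"
      using prob_G[of t] t by linarith
    then have "(1 - \<eta>) * (1 - 2 * \<eta>) \<le> (1 - \<eta>) * prob (G t)"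
      using \<eta> by (intro mult_left_mono) auto
    moreover have "1 - 3 * \<eta> \<le> (1 - \<eta>) * (1 - 2 * \<eta>)"
      by (simp add: algebra_simps)
    ultimately show "a < pull_prob N \<Theta> (markov_policy N Q) t ?j"
      using \<eta>(3) by linarith
  qed
qed

text \<open>The regret is the sum of the losses \<open>d t\<close>, which lie between
  \<open>0\<close> and the optimal mean times the probability of not pulling the optimal arm. So
  they vanish, and so do their averages.\<close>

lemma regret_quotient_tendsto: "(\<lambda>T. regret N \<Theta> (markov_policy N Q) T / real T) \<longlonglongrightarrow> 0"
proof -
  define d where "d t = optimal_mean N \<Theta> - expectation (\<lambda>\<omega>. snd (\<omega> t))" for t
  have "d \<longlonglongrightarrow> 0"
  proof (rule tendsto_sandwich)
    show "eventually (\<lambda>t. 0 \<le> d t) sequentially"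
      by (simp add: d_def expectation_reward_le)
    show "eventually (\<lambda>t. d t \<le> optimal_mean N \<Theta> -
        optimal_mean N \<Theta> * pull_prob N \<Theta> (markov_policy N Q) t (optimal_arm N \<Theta>)) sequentially"
      using expectation_reward_ge[OF optimal_arm(1)] by (simp add: d_def optimal_arm(2))
    show "(\<lambda>t. optimal_mean N \<Theta> -
        optimal_mean N \<Theta> * pull_prob N \<Theta> (markov_policy N Q) t (optimal_arm N \<Theta>)) \<longlonglongrightarrow> 0"
      by (rule tendsto_eq_intros pull_prob_tendsto refl | simp)+
  qed simp
  moreover have "regret N \<Theta> (markov_policy N Q) T = (\<Sum>t<T. d t)" for T
    by (simp add: regret_def expected_reward_eq d_def sum_subtractf mult.commute)
  ultimately show ?thesis
    using cesaro_null[of d] by simp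
qed

lemma long_run_average_eq: "long_run_average N \<Theta> (markov_policy N Q) = ereal (optimal_mean N \<Theta>)"
proof -
  have "(\<lambda>T. optimal_mean N \<Theta> - regret N \<Theta> (markov_policy N Q) T / real T) \<longlonglongrightarrow> optimal_mean N \<Theta> - 0"
    by (intro tendsto_intros regret_quotient_tendsto)
  \<comment> \<open>The identity is needed only for positive \<open>T\<close>; at \<open>0\<close>
    both quotients are \<open>0\<close> by convention.\<close>
  moreover have "eventually (\<lambda>T. optimal_mean N \<Theta> - regret N \<Theta> (markov_policy N Q) T / real T =
      expected_reward N \<Theta> (markov_policy N Q) T / real T) sequentially"
    using eventually_gt_at_top[of 0] by eventually_elim (simp add: regret_def field_simps)
  ultimately have "(\<lambda>T. expected_reward N \<Theta> (markov_policy N Q) T / real T) \<longlonglongrightarrow> optimal_mean N \<Theta>"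
    by (simp add: tendsto_cong)
  then show ?thesis
    unfolding long_run_average_def by (intro lim_imp_Limsup) simp_all
qed

end

theorem theorem4:
  fixes N :: nat
    and Q :: "nat \<Rightarrow> (nat \<Rightarrow> nat) \<times> (nat \<Rightarrow> real) \<Rightarrow> real"
    and \<Theta> :: "nat \<Rightarrow> real measure"
  assumes "N > 1"
    and "probability_function N Q"
    and "anonymous N Q"
    and "recurrent N Q"
    and "leading_arm_convergent N Q"
    and "bandit_instance N \<Theta>"
  shows "(\<lambda>t. pull_prob N \<Theta> (markov_policy N Q) t (optimal_arm N \<Theta>)) \<longlonglongrightarrow> 1 \<and>
         asymp_o (regret N \<Theta> (markov_policy N Q)) (\<lambda>T. real T) \<and>
         is_arg_max (long_run_average N \<Theta>) (admissible_policy N) (markov_policy N Q)"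
proof -
  interpret markov_bandit N Q \<Theta>
    by standard (use assms in auto)
  have "asymp_o (regret N \<Theta> (markov_policy N Q)) (\<lambda>T. real T)"
    unfolding asymp_o_def zero_ereal_def
    by (intro lim_imp_Limsup) (simp_all add: regret_quotient_tendsto)
  \<comment> \<open>The policy attains the optimal mean, which bounds every competitor through the
    locale for arbitrary admissible policies.\<close>
  moreover have "is_arg_max (long_run_average N \<Theta>) (admissible_policy N) (markov_policy N Q)"
    unfolding is_arg_max_linorder long_run_average_eq
    using bandit.long_run_average_le[OF bandit.intro[OF inst]] adm by blast
  ultimately show ?thesis
    using pull_prob_tendsto by blast
qed

end
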